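(* Let $d\ge 2$, let $X\subset\mathbb{R}^d\setminus\{0\}$ be finite, $w:X\to\mathbb{R}_{>0}$, and suppose $(X,w)$ is a strong Euclidean $t$-design and $X$ lies on exactly $p$ concentric spheres centered at the origin (i.e. $|\{\|x\|:x\in X\}|=p$). Let $e$ be a non-negative integer and assume $p\ge e+1$. Then: (1) if $t=2e$, then $|X|\ge (e+1)\left\{\binom{d+e-1}{e}+\binom{d+e-2}{e-1}\right\}$; (2) if $t=2e+1$ and $(X,w)$ is antipodal, then $|X|\ge 2(e+1)\binom{d+e-1}{e}$.
   Context: For $x\ne 0$ write $x'=x/\|x\|$. $Q_j$ denotes the Gegenbauer polynomial of degree $j$ for $S^{d-1}$ (orthogonal on $[-1,1]$ with respect to the weight $(1-t^2)^{(d-3)/2}$, normalized by $Q_j(1)=\dim\mathrm{Harm}_j(\mathbb{R}^d)$, the dimension of the space of homogeneous harmonic polynomials of degree $j$). $(X,w)$ is a strong Euclidean $t$-design if $\sum_{x,y\in X} w(x)w(y)(\|x\|\|y\|)^i Q_j(x'\cdot y')=0$ for all $0\le i\le t$ and $1\le j\le t$. $(X,w)$ is antipodal if $X=-X$ and $w(x)=w(-x)$ for all $x\in X$. Binomial coefficients $\binom{n}{-1}$ are $0$. *)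

theory Defs
  imports
    "HOL-Analysis.Analysis"
    "HOL-Computational_Algebra.Polynomial"
    "HOL-Library.Function_Algebras"
begin

text \<open>
  The second derivative at \<open>x\<close> in direction \<open>axis i 1\<close> is that of
  \<open>s \<mapsto> f (x + s *\<^sub>R axis i 1)\<close> at \<open>s = 0\<close>.
  It is applied only to polynomial functions, where no differentiability question arises.
\<close>
definition laplacian :: "(real ^ 'n \<Rightarrow> real) \<Rightarrow> real ^ 'n \<Rightarrow> real" where
  "laplacian f x = (\<Sum>i\<in>UNIV. (deriv ^^ 2) (\<lambda>s::real. f (x + s *\<^sub>R axis i 1)) 0)"

text \<open>
  Polynomials over an infinite field are identified with the functions they induce.
\<close>
definition Harm :: "nat \<Rightarrow> (real ^ 'n \<Rightarrow> real) set" where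
  "Harm j = {f. real_polynomial_function f \<and>
                (\<forall>c x. f (c *\<^sub>R x) = c ^ j * f x) \<and>
                (\<forall>x. laplacian f x = 0)}"

text \<open>
  Function types are not an instance of \<^class>\<open>real_vector\<close>, so the pointwise scalar
  multiplication is passed to the dimension explicitly.
\<close>
definition dim_Harm :: "'n::finite itself \<Rightarrow> nat \<Rightarrow> nat" where
  "dim_Harm _ j =
     vector_space.dim (\<lambda>(c::real) (f :: real ^ 'n \<Rightarrow> real) x. c * f x) (Harm j)"

text \<open>
  For \<open>d = CARD('n) \<ge> 2\<close> the exponent is greater than \<open>-1\<close>, so the weight is integrable;
  its value at the endpoints is immaterial.
\<close>
definition gegenbauer_inner :: "'n::finite itself \<Rightarrow> real poly \<Rightarrow> real poly \<Rightarrow> real" where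
  "gegenbauer_inner _ p q =
     integral {-1..1} (\<lambda>s. poly p s * poly q s * (1 - s\<^sup>2) powr ((real CARD('n) - 3) / 2))"

text \<open>
  For \<open>CARD('n) \<ge> 2\<close> exactly one family satisfies the description.
\<close>
definition gegenbauer :: "'n::finite itself \<Rightarrow> nat \<Rightarrow> real poly" where
  "gegenbauer T = (THE Q. \<forall>j.
     degree (Q j) = j \<and>
     (\<forall>k. k \<noteq> j \<longrightarrow> gegenbauer_inner T (Q j) (Q k) = 0) \<and>
     poly (Q j) 1 = real (dim_Harm T j))"

text \<open>
  Here \<open>sgn x\<close> is the unit vector \<open>x /\<^sub>R norm x\<close>.
\<close>
definition strong_euclidean_design ::
    "nat \<Rightarrow> (real ^ 'n::finite) set \<Rightarrow> (real ^ 'n \<Rightarrow> real) \<Rightarrow> bool" where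
  "strong_euclidean_design t X w \<longleftrightarrow>
     (\<forall>i\<in>{0..t}. \<forall>j\<in>{1..t}.
        (\<Sum>x\<in>X. \<Sum>y\<in>X. w x * w y * (norm x * norm y) ^ i *
           poly (gegenbauer TYPE('n) j) (sgn x \<bullet> sgn y)) = 0)"

definition antipodal :: "(real ^ 'n::finite) set \<Rightarrow> (real ^ 'n \<Rightarrow> real) \<Rightarrow> bool" where
  "antipodal X w \<longleftrightarrow> X = uminus ` X \<and> (\<forall>x\<in>X. w x = w (- x))"

end

theory Submission
  imports Defs "HOL-Library.Multiset" "HOL-Computational_Algebra.Formal_Power_Series"
begin

text \<open>
  Let \<open>a x = w x * norm x ^ i\<close> with \<open>i \<le> t\<close>. Since \<open>Q\<^sub>j\<close> has degree \<open>j\<close> and is orthogonal to the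
  constants for \<open>j \<ge> 1\<close>, the design condition says that
  \<open>\<Sum> a x a y (x' \<bullet> y') ^ k = (\<Sum> a x)\<^sup>2 m\<^sub>k\<close> for \<open>k \<le> t\<close>, where \<open>m\<^sub>k\<close> is the \<open>k\<close>-th moment of
  the normalized Gegenbauer weight. Expanding \<open>(x' \<bullet> y') ^ k\<close> by the multinomial theorem, this
  turns into the vanishing of a weighted sum of squares of the differences between the degree
  \<open>k\<close> moments of the measure \<open>\<Sum> a x \<delta>\<^bsub>x'\<^esub>\<close> and those of the uniform measure on the sphere, so
  all these moments agree; neither harmonic projections nor the addition formula are needed.

  If there were fewer points than claimed, some nonzero \<open>F = \<Sum> r ^ i f\<^sub>i (x')\<close> with \<open>i \<le> e\<close> and
  \<open>f\<^sub>i\<close> of degree at most \<open>e\<close> would vanish on \<open>X\<close>. Integrating \<open>F\<^sup>2\<close> against \<open>w\<close> gives a sum over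
  \<open>x\<close> of positive multiples of spherical means of \<open>(\<Sum> norm x ^ i f\<^sub>i)\<^sup>2\<close>, so these polynomials
  vanish for more than \<open>e\<close> values of \<open>norm x\<close>, whence all \<open>f\<^sub>i\<close> are \<open>0\<close>.

  The uniform measure on the sphere enters only through its moments, which are those of the
  Gaussian measure up to a factor depending on the degree; positivity is read off from the
  triangular expansion of monomials in Hermite polynomials.
\<close>

section \<open>Homogeneous linear systems with more unknowns than equations\<close>

text \<open>Gaussian elimination, with one equation per point of \<open>X\<close>: each point
  removed costs at most one unknown. This supplies both the orthogonal polynomials and the function
  vanishing on a design that is too small.\<close>

lemma exists_nontrivial_solution:
  fixes g :: "'j \<Rightarrow> 'x \<Rightarrow> real"
  assumes "finite X" "finite J" "card X < card J"
  shows "\<exists>c. (\<exists>j\<in>J. c j \<noteq> 0) \<and> (\<forall>x\<in>X. (\<Sum>j\<in>J. c j * g j x) = 0)"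
  using assms
proof (induction X arbitrary: J g rule: finite_induct)
  case empty
  then obtain j where "j \<in> J" by (metis card.empty equals0I less_irrefl)
  then show ?case by (intro exI[of _ "\<lambda>_. 1"]) auto
next
  case (insert x X)
  show ?case
  proof (cases "\<forall>j\<in>J. g j x = 0")
    case True
    have "card X < card J" using insert by simp
    from insert.IH[OF insert.prems(1) this, of g] obtain c
      where "\<exists>j\<in>J. c j \<noteq> 0" "\<forall>x\<in>X. (\<Sum>j\<in>J. c j * g j x) = 0" by blast
    with True show ?thesis by (intro exI[of _ c]) simp
  next
    case False
    then obtain k where k: "k \<in> J" "g k x \<noteq> 0" by auto
    \<comment> \<open>Column operations with pivot \<open>g k x\<close> clear the equation at
      \<open>x\<close>, so \<open>h j x = 0\<close> for all \<open>j\<close>.\<close>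
    define h where "h = (\<lambda>j y. g j y - g j x / g k x * g k y)"
    have "card X < card (J - {k})" using insert k by simp
    from insert.IH[OF _ this, of h] insert.prems(1) obtain c
      where c: "\<exists>j\<in>J - {k}. c j \<noteq> 0" "\<forall>y\<in>X. (\<Sum>j\<in>J - {k}. c j * h j y) = 0" by blast
    \<comment> \<open>The coefficient at \<open>k\<close> collects what the column operations have
      subtracted.\<close>
    define c' where "c' = c(k := - (\<Sum>j\<in>J - {k}. c j * (g j x / g k x)))"
    have eq: "(\<Sum>j\<in>J. c' j * g j y) = (\<Sum>j\<in>J - {k}. c j * h j y)" for y
    proof -
      have "(\<Sum>j\<in>J. c' j * g j y) = c' k * g k y + (\<Sum>j\<in>J - {k}. c' j * g j y)"
        using k insert.prems by (simp add: sum.remove)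
      also have "(\<Sum>j\<in>J - {k}. c' j * g j y) = (\<Sum>j\<in>J - {k}. c j * g j y)"
        by (intro sum.cong) (auto simp: c'_def)
      also have "c' k * g k y = - (\<Sum>j\<in>J - {k}. c j * (g j x / g k x * g k y))"
        by (simp add: c'_def sum_distrib_right mult.assoc)
      finally show ?thesis by (simp add: h_def right_diff_distrib sum_subtractf)
    qed
    have "(\<Sum>j\<in>J. c' j * g j x) = 0" unfolding eq using k by (simp add: h_def)
    moreover have "\<exists>j\<in>J. c' j \<noteq> 0" using c(1) by (auto simp: c'_def)
    ultimately show ?thesis using c(2) by (intro exI[of _ c']) (simp add: eq)
  qed
qed

section \<open>Exponent vectors\<close>

definition expts :: "nat \<Rightarrow> ('n::finite \<Rightarrow> nat) set" where
  "expts k = {\<alpha>. sum \<alpha> UNIV = k}"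

lemma expts_le: "\<alpha> \<in> expts k \<Longrightarrow> \<alpha> i \<le> k"
  unfolding expts_def using member_le_sum[of i UNIV \<alpha>] by auto

lemma finite_expts [simp]: "finite (expts k :: ('n::finite \<Rightarrow> nat) set)"
proof (rule finite_subset)
  show "expts k \<subseteq> Pi\<^sub>E (UNIV::'n set) (\<lambda>_. {..k})"
    using expts_le by auto
qed (auto intro: finite_PiE)

lemma expts_0 [simp]: "expts 0 = {\<lambda>_. 0}"
  by (auto simp: expts_def fun_eq_iff)

text \<open>The binomial count and the coefficients of a product of power series are both known in
  terms of multisets; this bijection transfers them.\<close>

lemma bij_betw_count_expts: "bij_betw count (multisets_of_size (UNIV::'n::finite set) k) (expts k)"
proof -
  have size: "size M = sum (count M) UNIV" for M :: "'n multiset"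
    unfolding size_multiset_overloaded_eq
    by (rule sum.mono_neutral_left) (auto simp: not_in_iff)
  show ?thesis
    by (rule bij_betwI[where g = Abs_multiset])
       (auto simp: multisets_of_size_def expts_def size count_inverse)
qed

lemma card_expts: "card (expts k :: ('n::finite \<Rightarrow> nat) set) = (CARD('n) + k - 1) choose k"
  using bij_betw_same_card[OF bij_betw_count_expts[where 'n = 'n, of k]]
  by (simp add: card_multisets_of_size)

lemma fps_nth_prod_UNIV:
  fixes F :: "'n::finite \<Rightarrow> 'b::comm_ring_1 fps"
  shows "fps_nth (\<Prod>i\<in>UNIV. F i) k = (\<Sum>\<alpha>\<in>expts k. \<Prod>i\<in>UNIV. fps_nth (F i) (\<alpha> i))"
  unfolding fps_prod_nth'[OF finite]
  by (rule sum.reindex_bij_betw[OF bij_betw_count_expts, where g = "\<lambda>\<alpha>. \<Prod>i\<in>UNIV. fps_nth (F i) (\<alpha> i)"])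

lemma fps_exp_sum: "finite I \<Longrightarrow> fps_exp (sum u I) = (\<Prod>i\<in>I. fps_exp (u i :: 'a::field_char_0))"
  by (induction I rule: finite_induct) (simp_all add: fps_exp_add_mult)

text \<open>Compare coefficients of degree \<open>k\<close> in the product formula for the
  exponential series.\<close>

lemma multinomial_UNIV:
  fixes u :: "'n::finite \<Rightarrow> real"
  shows "(\<Sum>\<alpha>\<in>expts k. \<Prod>i\<in>UNIV. u i ^ \<alpha> i / fact (\<alpha> i)) = (\<Sum>i\<in>UNIV. u i) ^ k / fact k"
  using arg_cong[OF fps_exp_sum[of UNIV u], of "\<lambda>F. fps_nth F k"]
  by (simp add: fps_nth_prod_UNIV)

section \<open>Gaussian moments\<close>

text \<open>\<open>hc n l\<close> is the coefficient of the Hermite polynomial \<open>He\<^sub>l\<close> in \<open>x ^ n\<close>; the recursion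
  is \<open>x He\<^sub>l = He\<^sub>l\<^sub>+\<^sub>1 + l He\<^sub>l\<^sub>-\<^sub>1\<close>. In particular \<open>hc n 0\<close> is the \<open>n\<close>-th moment of the standard
  normal distribution.\<close>
fun hc :: "nat \<Rightarrow> nat \<Rightarrow> real" where
  "hc 0 l = (if l = 0 then 1 else 0)"
| "hc (Suc n) l = (if l = 0 then 0 else hc n (l - 1)) + real (l + 1) * hc n (l + 1)"

abbreviation gmom :: "nat \<Rightarrow> real" where "gmom n \<equiv> hc n 0"

lemma hc_eq_0: "n < l \<Longrightarrow> hc n l = 0"
  by (induction n arbitrary: l) auto

lemma hc_diag [simp]: "hc n n = 1"
  by (induction n) (simp_all add: hc_eq_0)

text \<open>Differentiate the Hermite expansion of \<open>x ^ (n + 1)\<close>: the derivative of the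
  Hermite polynomial of index \<open>l + 1\<close> is \<open>l + 1\<close> times that of index
  \<open>l\<close>.\<close>

lemma hc_derivative: "real (Suc l) * hc (Suc n) (Suc l) = real (Suc n) * hc n l"
proof (induction n arbitrary: l)
  case 0
  show ?case by simp
next
  case (Suc n)
  have "real (Suc l) * hc (Suc (Suc n)) (Suc l)
      = real (Suc l) * hc (Suc n) l + real (Suc l) * (real (Suc (Suc l)) * hc (Suc n) (Suc (Suc l)))"
    by (simp add: algebra_simps)
  also have "\<dots> = real (Suc l) * hc (Suc n) l + real (Suc l) * (real (Suc n) * hc n (Suc l))"
    by (simp only: Suc.IH)
  also have "\<dots> = real (Suc (Suc n)) * hc (Suc n) l"
  proof (cases l)
    case 0
    then show ?thesis by (simp add: algebra_simps)
  next
    case (Suc m)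
    have "real l * hc (Suc n) l = real (Suc n) * hc n m"
      using Suc.IH[of m] Suc by simp
    moreover have "hc (Suc n) l = hc n m + real (Suc l) * hc n (Suc l)"
      using Suc by simp
    ultimately show ?thesis by (simp add: algebra_simps del: hc.simps)
  qed
  finally show ?case .
qed

lemma gmom_Suc_Suc: "gmom (Suc (Suc n)) = real (Suc n) * gmom n"
  using hc_derivative[of 0 n] by simp

lemma gmom_1 [simp]: "gmom (Suc 0) = 0"
  by simp

lemma gmom_odd: "odd n \<Longrightarrow> gmom n = 0"
  by (induction n rule: induct_nat_012) (auto simp: gmom_Suc_Suc simp del: hc.simps(2))

text \<open>Hermite polynomials are orthogonal with squared norm \<open>fact l\<close>, so the sum
  is the Gaussian mean of \<open>x ^ m * x ^ n\<close>. The induction passes one factor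
  \<open>x\<close> from the first power to the second.\<close>

lemma hc_orthogonality:
  "m + n \<le> N \<Longrightarrow> (\<Sum>l\<le>N. fact l * hc m l * hc n l) = gmom (m + n)"
proof (induction m arbitrary: n)
  case 0
  have "(\<Sum>l\<le>N. fact l * hc 0 l * hc n l) = (\<Sum>l\<in>{0}. fact l * hc 0 l * hc n l)"
    by (rule sum.mono_neutral_right) auto
  then show ?case by simp
next
  case (Suc m)
  obtain N' where N': "N = Suc N'" using Suc.prems by (cases N) auto
  \<comment> \<open>Exchanging \<open>p\<close> and \<open>q\<close> only swaps the two sums on the
    right, which is the symmetry of multiplication by \<open>x\<close>.\<close>
  have shift: "(\<Sum>l\<le>N. fact l * hc (Suc p) l * hc q l) =
      (\<Sum>l\<le>N'. fact (Suc l) * hc p l * hc q (Suc l)) +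
      (\<Sum>l\<le>N'. fact (Suc l) * hc p (Suc l) * hc q l)"
    if "p + q < N" for p q
  proof -
    have "(\<Sum>l\<le>N. fact l * hc (Suc p) l * hc q l) =
      (\<Sum>l\<le>N. fact l * (if l = 0 then 0 else hc p (l - 1)) * hc q l) +
      (\<Sum>l\<le>N. fact l * (real (l + 1) * hc p (l + 1)) * hc q l)"
      by (simp add: algebra_simps sum.distrib)
    also have "(\<Sum>l\<le>N. fact l * (if l = 0 then 0 else hc p (l - 1)) * hc q l) =
       (\<Sum>l\<le>N'. fact (Suc l) * hc p l * hc q (Suc l))"
      unfolding N' sum.atMost_Suc_shift by simp
    also have "(\<Sum>l\<le>N. fact l * (real (l + 1) * hc p (l + 1)) * hc q l) =
       (\<Sum>l\<le>N'. fact (Suc l) * hc p (Suc l) * hc q l)"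
      using that by (simp add: N' hc_eq_0 algebra_simps)
    finally show ?thesis .
  qed
  have "(\<Sum>l\<le>N. fact l * hc (Suc m) l * hc n l) = (\<Sum>l\<le>N. fact l * hc (Suc n) l * hc m l)"
    using shift[of m n] shift[of n m] Suc.prems by (simp add: mult_ac add_ac del: hc.simps fact_Suc)
  also have "\<dots> = (\<Sum>l\<le>N. fact l * hc m l * hc (Suc n) l)"
    by (simp add: mult_ac)
  also have "\<dots> = gmom (m + Suc n)"
    using Suc.prems by (intro Suc.IH) auto
  finally show ?case by simp
qed

section \<open>Generating functions of Gaussian moments\<close>

text \<open>A Gaussian vector projected to a unit direction is standard normal. In terms of series,
  each factor solves \<open>G' = (u i)^2 X G\<close>; in the product the factors
  \<open>(u i)^2\<close> add up to 1, which leaves the recursion of \<open>gmom\<close>.\<close>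

lemma sum_expts_gmom:
  fixes u :: "'n::finite \<Rightarrow> real"
  assumes "(\<Sum>i\<in>UNIV. (u i)\<^sup>2) = 1"
  shows "(\<Sum>\<alpha>\<in>expts k. \<Prod>i\<in>UNIV. u i ^ \<alpha> i * gmom (\<alpha> i) / fact (\<alpha> i)) = gmom k / fact k"
proof -
  define G where "G = (\<lambda>i. Abs_fps (\<lambda>n. u i ^ n * gmom n / fact n))"
  have dG: "fps_deriv (G i) = fps_const ((u i)\<^sup>2) * fps_X * G i" for i
  proof (rule fps_ext)
    fix n show "fps_nth (fps_deriv (G i)) n = fps_nth (fps_const ((u i)\<^sup>2) * fps_X * G i) n"
    proof (cases n)
      case 0
      then show ?thesis by (simp add: G_def mult.assoc)
    next
      case (Suc m)
      then show ?thesis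
        by (simp add: G_def mult.assoc gmom_Suc_Suc power2_eq_square del: hc.simps(2) of_nat_Suc)
    qed
  qed
  have dP: "fps_deriv (\<Prod>i\<in>I. G i) = fps_const (\<Sum>i\<in>I. (u i)\<^sup>2) * fps_X * (\<Prod>i\<in>I. G i)" for I
    by (induction I rule: infinite_finite_induct)
       (simp_all add: dG algebra_simps flip: fps_const_add)
  define P where "P = (\<Prod>i\<in>UNIV. G i)"
  have P': "fps_deriv P = fps_X * P"
    using dP[of UNIV] assms by (simp add: P_def)
  have "fps_nth P k = gmom k / fact k"
  proof (induction k rule: induct_nat_012)
    case 0
    show ?case by (simp add: P_def G_def fps_nth_prod_UNIV)
  next
    case 1
    show ?case using arg_cong[OF P', of "\<lambda>F. fps_nth F 0"] by simp
  next
    case (ge2 n)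
    have "real (Suc (Suc n)) * fps_nth P (Suc (Suc n)) = fps_nth P n"
      using arg_cong[OF P', of "\<lambda>F. fps_nth F (Suc n)"] by simp
    then have "fps_nth P (Suc (Suc n)) = gmom n / fact n / real (Suc (Suc n))"
      by (simp add: ge2 field_simps del: of_nat_Suc)
    then show ?case
      by (simp add: gmom_Suc_Suc del: hc.simps(2) of_nat_Suc)
  qed
  then show ?thesis by (simp add: P_def fps_nth_prod_UNIV G_def)
qed

text \<open>For even \<open>k\<close> this is the \<open>k\<close>-th moment of the norm of a standard Gaussian vector in \<open>d\<close>
  dimensions; for odd \<open>k\<close> any nonzero value would do.\<close>
fun chi_mom :: "nat \<Rightarrow> nat \<Rightarrow> real" where
  "chi_mom d 0 = 1"
| "chi_mom d (Suc 0) = 1"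
| "chi_mom d (Suc (Suc k)) = real (k + d) * chi_mom d k"

lemma chi_mom_pos: "d > 0 \<Longrightarrow> chi_mom d k > 0"
  by (induction d k rule: chi_mom.induct) auto

lemma fps_nth_one_minus_X2_deriv:
  "fps_nth ((1 - fps_X\<^sup>2) * fps_deriv F) (Suc m) =
     real (Suc (Suc m)) * fps_nth F (Suc (Suc m)) - real m * fps_nth F m"
  by (cases m) (simp_all add: left_diff_distrib fps_X_power_mult_nth)

text \<open>Both sides are the mean of \<open>(x \<bullet> y) ^ k / fact k\<close> for independent
  Gaussian vectors. Here \<open>H\<close> is the series of \<open>(1 - X^2) powr (-1/2)\<close>, and
  the differential equation of its \<open>d\<close>-th power yields the recursion of the right
  side.\<close>

lemma sum_expts_gmom_square:
  "(\<Sum>\<alpha>\<in>(expts k :: ('n::finite \<Rightarrow> nat) set). \<Prod>i\<in>UNIV. (gmom (\<alpha> i))\<^sup>2 / fact (\<alpha> i)) =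
     gmom k * chi_mom CARD('n) k / fact k"
proof -
  define H where "H = Abs_fps (\<lambda>n. (gmom n)\<^sup>2 / fact n)"
  have dH: "(1 - fps_X\<^sup>2) * fps_deriv H = fps_X * H"
  proof (rule fps_ext)
    fix n show "fps_nth ((1 - fps_X\<^sup>2) * fps_deriv H) n = fps_nth (fps_X * H) n"
    proof (cases n)
      case 0
      then show ?thesis by (simp add: H_def power2_eq_square mult.assoc algebra_simps)
    next
      case (Suc m)
      have "real (Suc (Suc m)) * fps_nth H (Suc (Suc m)) = real (Suc m) * fps_nth H m"
        by (simp add: H_def gmom_Suc_Suc power2_eq_square del: hc.simps(2) of_nat_Suc)
      then show ?thesis
        unfolding Suc fps_nth_one_minus_X2_deriv by (simp add: algebra_simps)
    qed
  qed
  define P where "P = (\<Prod>i\<in>(UNIV::'n set). H)"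
  have "(1 - fps_X\<^sup>2) * fps_deriv (H ^ d) = of_nat d * fps_X * H ^ d" for d
  proof (induction d)
    case (Suc d)
    have "(1 - fps_X\<^sup>2) * fps_deriv (H ^ Suc d) =
       ((1 - fps_X\<^sup>2) * fps_deriv H) * H ^ d + H * ((1 - fps_X\<^sup>2) * fps_deriv (H ^ d))"
      by (simp add: algebra_simps)
    also have "\<dots> = of_nat (Suc d) * fps_X * H ^ Suc d"
      unfolding dH Suc.IH by (simp add: algebra_simps)
    finally show ?case .
  qed simp
  then have P': "(1 - fps_X\<^sup>2) * fps_deriv P = of_nat CARD('n) * fps_X * P"
    by (simp add: P_def)
  have "fps_nth P k = gmom k * chi_mom CARD('n) k / fact k"
  proof (induction k rule: induct_nat_012)
    case 0
    show ?case by (simp add: P_def H_def fps_power_zeroth)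
  next
    case 1
    show ?case using arg_cong[OF P', of "\<lambda>F. fps_nth F 0"] by simp
  next
    case (ge2 n)
    have "real (Suc (Suc n)) * fps_nth P (Suc (Suc n)) = real (n + CARD('n)) * fps_nth P n"
      using arg_cong[OF P', of "\<lambda>F. fps_nth F (Suc n)"]
      unfolding fps_nth_one_minus_X2_deriv by (simp add: mult.assoc algebra_simps flip: fps_of_nat)
    then have "fps_nth P (Suc (Suc n)) =
        real (n + CARD('n)) * (gmom n * chi_mom CARD('n) n / fact n) / real (Suc (Suc n))"
      by (simp add: ge2 field_simps del: of_nat_Suc of_nat_add)
    then show ?case
      by (simp add: gmom_Suc_Suc mult_ac del: hc.simps(2) of_nat_Suc of_nat_add)
  qed
  then show ?thesis unfolding P_def fps_nth_prod_UNIV by (simp add: H_def)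
qed

text \<open>\<open>B\<close> is the Gaussian mean of the square of a form of degree \<open>k\<close>
  with coefficients \<open>c\<close>. Expansion in products of Hermite polynomials makes it
  diagonal.\<close>

lemma gmom_form:
  fixes c :: "('n::finite \<Rightarrow> nat) \<Rightarrow> real" and k :: nat
  defines "B \<equiv> (\<Sum>\<alpha>\<in>expts k. \<Sum>\<beta>\<in>expts k. c \<alpha> * c \<beta> * (\<Prod>i\<in>UNIV. gmom (\<alpha> i + \<beta> i)))"
  shows gmom_form_nonneg: "B \<ge> 0"
    and gmom_form_eq_0: "B = 0 \<Longrightarrow> \<alpha> \<in> expts k \<Longrightarrow> c \<alpha> = 0"
proof -
  \<comment> \<open>The range \<open>2*k\<close> bounds \<open>\<alpha> i + \<beta> i\<close>, as
    \<open>hc_orthogonality\<close> requires.\<close>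
  define N where "N = Pi\<^sub>E (UNIV::'n set) (\<lambda>_. {..2*k})"
  \<comment> \<open>The coefficient of the Hermite product with index \<open>\<nu>\<close> in that
    form.\<close>
  define T where "T = (\<lambda>\<nu>. \<Sum>\<alpha>\<in>expts k. c \<alpha> * (\<Prod>i\<in>UNIV. hc (\<alpha> i) (\<nu> i)))"
  have fin: "finite N" unfolding N_def by (intro finite_PiE) auto
  have prod: "(\<Prod>i\<in>UNIV. gmom (\<alpha> i + \<beta> i)) =
     (\<Sum>\<nu>\<in>N. (\<Prod>i\<in>UNIV. fact (\<nu> i)) * (\<Prod>i\<in>UNIV. hc (\<alpha> i) (\<nu> i)) * (\<Prod>i\<in>UNIV. hc (\<beta> i) (\<nu> i)))"
    if "\<alpha> \<in> expts k" "\<beta> \<in> expts k" for \<alpha> \<beta> :: "'n \<Rightarrow> nat"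
  proof -
    have "(\<Prod>i\<in>UNIV. gmom (\<alpha> i + \<beta> i)) = (\<Prod>i\<in>UNIV. \<Sum>l\<le>2*k. fact l * hc (\<alpha> i) l * hc (\<beta> i) l)"
      using that expts_le[of \<alpha> k] expts_le[of \<beta> k]
      by (intro prod.cong refl hc_orthogonality[symmetric]) (metis add_mono mult_2)
    also have "\<dots> = (\<Sum>\<nu>\<in>N. \<Prod>i\<in>UNIV. fact (\<nu> i) * hc (\<alpha> i) (\<nu> i) * hc (\<beta> i) (\<nu> i))"
      unfolding N_def by (rule prod_sum_PiE) auto
    finally show ?thesis by (simp add: prod.distrib)
  qed
  have B: "B = (\<Sum>\<nu>\<in>N. (\<Prod>i\<in>UNIV. fact (\<nu> i)) * (T \<nu>)\<^sup>2)"
  proof -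
    have "B = (\<Sum>\<alpha>\<in>expts k. \<Sum>\<beta>\<in>expts k. \<Sum>\<nu>\<in>N. (\<Prod>i\<in>UNIV. fact (\<nu> i)) *
        ((c \<alpha> * (\<Prod>i\<in>UNIV. hc (\<alpha> i) (\<nu> i))) * (c \<beta> * (\<Prod>i\<in>UNIV. hc (\<beta> i) (\<nu> i)))))"
      unfolding B_def by (intro sum.cong refl) (simp add: prod sum_distrib_left mult_ac)
    also have "\<dots> = (\<Sum>\<alpha>\<in>expts k. \<Sum>\<nu>\<in>N. \<Sum>\<beta>\<in>expts k. (\<Prod>i\<in>UNIV. fact (\<nu> i)) *
        ((c \<alpha> * (\<Prod>i\<in>UNIV. hc (\<alpha> i) (\<nu> i))) * (c \<beta> * (\<Prod>i\<in>UNIV. hc (\<beta> i) (\<nu> i)))))"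
      by (intro sum.cong refl sum.swap)
    also have "\<dots> = (\<Sum>\<nu>\<in>N. \<Sum>\<alpha>\<in>expts k. \<Sum>\<beta>\<in>expts k. (\<Prod>i\<in>UNIV. fact (\<nu> i)) *
        ((c \<alpha> * (\<Prod>i\<in>UNIV. hc (\<alpha> i) (\<nu> i))) * (c \<beta> * (\<Prod>i\<in>UNIV. hc (\<beta> i) (\<nu> i)))))"
      by (rule sum.swap)
    also have "\<dots> = (\<Sum>\<nu>\<in>N. (\<Prod>i\<in>UNIV. fact (\<nu> i)) * (T \<nu>)\<^sup>2)"
      unfolding T_def power2_eq_square sum_product by (simp only: sum_distrib_left)
    finally show ?thesis .
  qed
  have nonneg: "(\<Prod>i\<in>UNIV. fact (\<nu> i)) * (T \<nu>)\<^sup>2 \<ge> 0" for \<nu>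
    by (intro mult_nonneg_nonneg prod_nonneg) auto
  show "B \<ge> 0" unfolding B by (intro sum_nonneg nonneg)
  assume "B = 0" "\<alpha> \<in> expts k"
  have "\<alpha> \<in> N" using expts_le[OF \<open>\<alpha> \<in> expts k\<close>] by (force simp: N_def intro: order_trans)
  then have "T \<alpha> = 0"
    using \<open>B = 0\<close> sum_nonneg_eq_0_iff[OF fin nonneg] unfolding B by simp
  moreover have "T \<alpha> = c \<alpha>"
  proof -
    \<comment> \<open>In top degree the expansion is trivial: of two distinct vectors with equal
      sums, each is below the other in some coordinate.\<close>
    have zero: "(\<Prod>i\<in>UNIV. hc (\<beta> i) (\<alpha> i)) = 0" if "\<beta> \<in> expts k" "\<beta> \<noteq> \<alpha>" for \<beta>
    proof -
      have "\<exists>i. \<beta> i < \<alpha> i"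
      proof (rule ccontr)
        assume "\<nexists>i. \<beta> i < \<alpha> i"
        then have le: "\<And>i. \<alpha> i \<le> \<beta> i" by (simp add: not_less)
        obtain i where "\<alpha> i \<noteq> \<beta> i" using \<open>\<beta> \<noteq> \<alpha>\<close> by (metis ext)
        then have "\<alpha> i < \<beta> i" using le by (simp add: order.strict_iff_order)
        then have "sum \<alpha> UNIV < sum \<beta> UNIV"
          using le by (intro sum_strict_mono_ex1) auto
        then show False using that \<open>\<alpha> \<in> expts k\<close> by (simp add: expts_def)
      qed
      then show ?thesis by (auto intro: hc_eq_0)
    qed
    have "T \<alpha> = (\<Sum>\<beta>\<in>{\<alpha>}. c \<beta> * (\<Prod>i\<in>UNIV. hc (\<beta> i) (\<alpha> i)))"
      unfolding T_def using \<open>\<alpha> \<in> expts k\<close> zero by (intro sum.mono_neutral_right) auto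
    then show ?thesis by simp
  qed
  ultimately show "c \<alpha> = 0" by simp
qed

section \<open>The Gegenbauer weight\<close>

definition geg_weight :: "nat \<Rightarrow> real \<Rightarrow> real" where
  "geg_weight d s = (1 - s\<^sup>2) powr ((real d - 3) / 2)"

definition geg_int :: "nat \<Rightarrow> real poly \<Rightarrow> real" where
  "geg_int d p = integral {-1..1} (\<lambda>s. poly p s * geg_weight d s)"

lemma gegenbauer_inner_eq:
  "gegenbauer_inner TYPE('n::finite) p q = geg_int CARD('n) (p * q)"
  by (simp add: gegenbauer_inner_def geg_int_def geg_weight_def)

text \<open>Since the base is at most 1, the weight is largest for \<open>d = 2\<close>, where it is
  the derivative of \<open>arcsin\<close>.\<close>

lemma geg_weight_le:
  assumes "d \<ge> 2" "\<bar>s\<bar> \<le> 1"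
  shows "geg_weight d s \<le> inverse (sqrt (1 - s\<^sup>2))"
proof -
  have s: "0 \<le> 1 - s\<^sup>2" "1 - s\<^sup>2 \<le> 1" using assms(2) by (auto simp: abs_square_le_1)
  have "geg_weight d s \<le> (1 - s\<^sup>2) powr (- (1 / 2))"
    unfolding geg_weight_def using assms(1) s by (intro powr_mono') auto
  also have "\<dots> = inverse (sqrt (1 - s\<^sup>2))"
    using s by (simp add: powr_minus powr_half_sqrt)
  finally show ?thesis .
qed

lemma geg_integrable:
  assumes "d \<ge> 2"
  shows "(\<lambda>s. poly p s * geg_weight d s) integrable_on {-1..1}"
proof -
  have "((\<lambda>s. inverse (sqrt (1 - s\<^sup>2))) has_integral (arcsin 1 - arcsin (- 1))) {-1..1}"
  proof (rule fundamental_theorem_of_calculus_interior)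
    show "continuous_on {-1..1} arcsin" by (rule continuous_on_arcsin')
    show "(arcsin has_vector_derivative inverse (sqrt (1 - s\<^sup>2))) (at s)" if "s \<in> {-1<..<1}" for s
      using that DERIV_arcsin[of s] by (simp add: has_real_derivative_iff_has_vector_derivative)
  qed simp
  then have int: "(\<lambda>s. inverse (sqrt (1 - s\<^sup>2))) integrable_on {-1..1}" by blast
  have "compact (poly p ` {-1..1})"
    by (intro compact_continuous_image continuous_intros) auto
  then obtain C where C: "C > 0" "\<forall>y\<in>poly p ` {-1..1}. norm y \<le> C"
    using compact_imp_bounded bounded_pos by metis
  have [measurable]: "poly p \<in> borel_measurable borel"
    by (intro borel_measurable_continuous_onI continuous_intros)
  have "(\<lambda>s. poly p s * geg_weight d s) \<in> borel_measurable borel"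
    unfolding geg_weight_def by measurable
  then have 1: "(\<lambda>s. poly p s * geg_weight d s) \<in> borel_measurable (lebesgue_on {-1..1})"
    by (intro measurable_restrict_space1 measurable_completion) simp
  have 2: "(\<lambda>s. C * inverse (sqrt (1 - s\<^sup>2))) integrable_on {-1..1}"
    using integrable_on_cmult_left[OF int, of C] by simp
  have 3: "norm (poly p s * geg_weight d s) \<le> C * inverse (sqrt (1 - s\<^sup>2))" if "s \<in> {-1..1}" for s
  proof -
    have "norm (geg_weight d s) \<le> inverse (sqrt (1 - s\<^sup>2))"
      using geg_weight_le[OF assms, of s] that by (simp add: geg_weight_def abs_le_iff)
    then show ?thesis
      unfolding norm_mult using C that by (intro mult_mono) auto
  qed
  show ?thesis
    by (rule measurable_bounded_by_integrable_imp_integrable[OF 1 2 3]) simp_all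
qed

lemma geg_int_add: "d \<ge> 2 \<Longrightarrow> geg_int d (p + q) = geg_int d p + geg_int d q"
  by (simp add: geg_int_def distrib_right integral_add geg_integrable)

lemma geg_int_smult: "geg_int d (smult c p) = c * geg_int d p"
  by (simp add: geg_int_def mult.assoc)

lemma geg_int_diff: "d \<ge> 2 \<Longrightarrow> geg_int d (p - q) = geg_int d p - geg_int d q"
  by (simp add: geg_int_def left_diff_distrib integral_diff geg_integrable)

lemma geg_int_0 [simp]: "geg_int d 0 = 0"
  by (simp add: geg_int_def)

lemma geg_int_sum: "d \<ge> 2 \<Longrightarrow> geg_int d (sum f A) = (\<Sum>i\<in>A. geg_int d (f i))"
  by (induction A rule: infinite_finite_induct) (auto simp: geg_int_add)

text \<open>The polynomial times the weight is the derivative of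
  \<open>q s * (1 - s^2) powr ((d - 1) / 2)\<close>, which vanishes at both endpoints.\<close>

lemma geg_int_by_parts:
  assumes "d \<ge> 2"
  shows "geg_int d (pderiv q * [:1, 0, -1:] - smult (real d - 1) ([:0, 1:] * q)) = 0"
proof -
  define c where "c = (real d - 1) / 2"
  have c: "c > 0" and dc: "real d = 2 * c + 1" using assms by (simp_all add: c_def field_simps)
  let ?r = "pderiv q * [:1, 0, -1:] - smult (real d - 1) ([:0, 1:] * q)"
  let ?F = "\<lambda>s. poly q s * (1 - s\<^sup>2) powr c"
  have deriv: "(?F has_vector_derivative poly ?r s * geg_weight d s) (at s)" if "s \<in> {-1<..<1}" for s
  proof -
    have s: "1 - s\<^sup>2 > 0" using that by (simp add: abs_square_less_1 abs_less_iff)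
    have "(1 - s\<^sup>2) powr c = (1 - s\<^sup>2) powr 1 * (1 - s\<^sup>2) powr (c - 1)"
      unfolding powr_add[symmetric] by simp
    also have "\<dots> = (1 - s\<^sup>2) * geg_weight d s"
      using s by (simp add: geg_weight_def c_def diff_divide_distrib)
    finally have 1: "(1 - s\<^sup>2) powr c = (1 - s\<^sup>2) * geg_weight d s" .
    have 2: "(1 - s\<^sup>2) powr (c - 1) = geg_weight d s"
      by (simp add: geg_weight_def c_def diff_divide_distrib)
    have "((\<lambda>s. (1 - s\<^sup>2) powr c) has_real_derivative c * (1 - s\<^sup>2) powr (c - of_nat 1) * (- 2 * s)) (at s)"
      using s by (intro DERIV_fun_powr) (auto intro!: derivative_eq_intros)
    note DERIV_mult[OF poly_DERIV[of q s] this]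
    moreover have "poly (pderiv q) s * (1 - s\<^sup>2) powr c + c * (1 - s\<^sup>2) powr (c - of_nat 1) * (- 2 * s) * poly q s
        = poly ?r s * geg_weight d s"
      unfolding of_nat_1 1 2 by (simp add: dc algebra_simps power2_eq_square)
    ultimately show ?thesis
      by (simp add: has_real_derivative_iff_has_vector_derivative)
  qed
  have "((\<lambda>s. poly ?r s * geg_weight d s) has_integral (?F 1 - ?F (-1))) {-1..1}"
    using c by (intro fundamental_theorem_of_calculus_interior deriv)
       (auto intro!: continuous_intros continuous_on_powr' simp: abs_square_le_1 abs_le_iff)
  then show ?thesis by (simp add: geg_int_def integral_unique)
qed

lemma geg_int_pos:
  assumes d: "d \<ge> 2" and p: "p \<noteq> 0" and nonneg: "\<And>s. \<bar>s\<bar> \<le> 1 \<Longrightarrow> poly p s \<ge> 0"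
  shows "geg_int d p > 0"
proof -
  let ?f = "\<lambda>s. poly p s * geg_weight d s"
  have f: "?f s \<ge> 0" if "s \<in> {-1..1}" for s
    using that nonneg[of s] unfolding geg_weight_def by (intro mult_nonneg_nonneg) auto
  have "geg_int d p \<ge> 0" unfolding geg_int_def by (intro integral_nonneg geg_integrable d f)
  moreover have "geg_int d p \<noteq> 0"
  proof
    assume 0: "geg_int d p = 0"
    \<comment> \<open>Strictness is decided on the middle interval, where the integrand is
      continuous; the weight may be singular at \<open>1\<close> and \<open>-1\<close>.\<close>
    have sub: "?f integrable_on {-1/2..1/2}"
      by (rule integrable_on_subinterval[OF geg_integrable[OF d]]) auto
    have "integral {-1/2..1/2} ?f \<le> geg_int d p"
      unfolding geg_int_def using f by (intro integral_subset_le sub geg_integrable d) auto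
    moreover have "integral {-1/2..1/2} ?f \<ge> 0"
      using f by (intro integral_nonneg sub) auto
    ultimately have "integral {-1/2..1/2} ?f = 0" using 0 by simp
    moreover have pos: "1 - s\<^sup>2 > 0" if "s \<in> {-1/2..1/2}" for s :: real
      using that by (simp add: abs_square_less_1 abs_less_iff)
    have "continuous_on {-1/2..1/2} ?f"
      unfolding geg_weight_def by (intro continuous_intros ballI) (use pos in force)+
    ultimately have "\<forall>s\<in>{-1/2..1/2}. ?f s = 0"
      using f by (subst (asm) integral_eq_0_iff) auto
    then have "\<forall>s\<in>{-1/2..1/2}. poly p s = 0"
      using pos by (force simp: geg_weight_def)
    then have "{-1/2..1/2} \<subseteq> {s. poly p s = 0}" by auto
    from finite_subset[OF this poly_roots_finite[OF p]] show False
      using infinite_Icc[of "-1/2" "1/2::real"] by simp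
  qed
  ultimately show ?thesis by simp
qed

lemma geg_int_square_pos: "d \<ge> 2 \<Longrightarrow> p \<noteq> 0 \<Longrightarrow> geg_int d (p * p) > 0"
  by (rule geg_int_pos) auto

definition geg_mom :: "nat \<Rightarrow> nat \<Rightarrow> real" where
  "geg_mom d k = geg_int d (monom 1 k) / geg_int d 1"

text \<open>Integration by parts with \<open>s ^ (n + 1)\<close> gives the ratio
  \<open>(n + 1) / (n + d)\<close> of the moments \<open>n + 2\<close> and \<open>n\<close>, which
  is the quotient of the recursions of \<open>gmom\<close> and \<open>chi_mom\<close>.\<close>

lemma geg_mom_eq:
  assumes d: "d \<ge> 2"
  shows "geg_mom d k = gmom k / chi_mom d k"
proof -
  have pos: "geg_int d 1 > 0" using d by (intro geg_int_pos) auto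
  have "geg_int d (monom 1 k) = gmom k / chi_mom d k * geg_int d 1"
  proof (induction k rule: induct_nat_012)
    case 0
    show ?case by simp
  next
    case 1
    have "pderiv 1 * [:1, 0, -1:] - smult (real d - 1) ([:0, 1:] * 1) = smult (1 - real d) (monom 1 (Suc 0))"
      by (simp add: monom_Suc monom_0 algebra_simps)
    with geg_int_by_parts[OF d, of 1] d show ?case by (simp add: geg_int_smult)
  next
    case (ge2 n)
    have "pderiv (monom 1 (Suc n)) * [:1, 0, -1:] - smult (real d - 1) ([:0, 1:] * monom 1 (Suc n))
      = smult (real (Suc n)) (monom 1 n) - smult (real (n + d)) (monom 1 (Suc (Suc n)))"
      by (rule poly_ext) (simp add: pderiv_monom poly_monom algebra_simps)
    with geg_int_by_parts[OF d, of "monom 1 (Suc n)"] d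
    have "real (n + d) * geg_int d (monom 1 (Suc (Suc n))) = real (Suc n) * geg_int d (monom 1 n)"
      by (simp only: geg_int_diff geg_int_smult)
    then have "geg_int d (monom 1 (Suc (Suc n))) = real (Suc n) * geg_int d (monom 1 n) / real (n + d)"
      using d by (simp add: field_simps)
    then show ?case by (simp add: ge2 gmom_Suc_Suc mult_ac del: hc.simps(2))
  qed
  then show ?thesis using pos by (simp add: geg_mom_def)
qed

section \<open>The Gegenbauer polynomials\<close>

text \<open>Subtracting a multiple of \<open>Q j\<close> for \<open>j = degree p\<close> removes the
  leading term, so polynomials of all degrees up to \<open>n\<close> span.\<close>

lemma poly_graded_induct:
  fixes Q :: "nat \<Rightarrow> real poly"
  assumes Q: "\<And>j. j \<le> n \<Longrightarrow> degree (Q j) = j \<and> Q j \<noteq> 0"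
    and p: "degree p \<le> n"
    and add: "\<And>p q. R p \<Longrightarrow> R q \<Longrightarrow> R (p + q)"
    and smult: "\<And>c p. R p \<Longrightarrow> R (smult c p)"
    and base: "\<And>j. j \<le> n \<Longrightarrow> R (Q j)"
  shows "R p"
  using p
proof (induction "degree p" arbitrary: p rule: less_induct)
  case less
  define j where "j = degree p"
  define c where "c = lead_coeff p / lead_coeff (Q j)"
  have Qj: "degree (Q j) = j" "lead_coeff (Q j) \<noteq> 0"
    using Q[of j] less.prems unfolding leading_coeff_0_iff by (simp_all add: j_def)
  define r where "r = p - smult c (Q j)"
  have r: "degree r \<le> j" "coeff r j = 0"
    unfolding r_def using Qj by (auto simp: j_def c_def intro!: degree_diff_le)
  have p: "p = smult c (Q j) + r" by (simp add: r_def)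
  have base': "R (smult c (Q j))" using smult base less.prems by (simp add: j_def)
  show ?case
  proof (cases "r = 0")
    case True
    with p base' show ?thesis by simp
  next
    case False
    then have "degree r < j" using r by (metis leading_coeff_0_iff le_neq_implies_less)
    then have "R r" using less by (simp add: j_def)
    then show ?thesis unfolding p using base' add by blast
  qed
qed

text \<open>Unlike orthogonality within a family, this concerns one degree at a time; it determines
  \<open>q\<close> up to a factor.\<close>

definition orth_lower :: "nat \<Rightarrow> nat \<Rightarrow> real poly \<Rightarrow> bool" where
  "orth_lower d j q \<longleftrightarrow> degree q = j \<and> q \<noteq> 0 \<and> (\<forall>p. degree p < j \<longrightarrow> geg_int d (q * p) = 0)"

text \<open>There are \<open>j\<close> conditions on \<open>j + 1\<close> coefficients. A solution
  of degree below \<open>j\<close> would be orthogonal to itself.\<close>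

lemma orth_lower_exists:
  assumes d: "d \<ge> 2"
  shows "\<exists>q. orth_lower d j q"
proof -
  obtain c where c: "\<exists>i\<in>{..j}. c i \<noteq> 0"
    "\<And>l. l \<in> {..<j} \<Longrightarrow> (\<Sum>i\<le>j. c i * geg_int d (monom 1 i * monom 1 l)) = 0"
    using exists_nontrivial_solution[of "{..<j}" "{..j}" "\<lambda>i l. geg_int d (monom 1 i * monom 1 l)"]
    by auto
  define q where "q = (\<Sum>i\<le>j. smult (c i) (monom 1 i))"
  have coeff_q: "coeff q i = (if i \<le> j then c i else 0)" for i
    by (simp add: q_def coeff_sum if_distrib[of "\<lambda>x. c _ * x"] cong: if_cong)
  have q0: "q \<noteq> 0" using c(1) coeff_q by (metis atMost_iff coeff_0)
  have orth: "geg_int d (q * p) = 0" if "degree p < j" for p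
  proof -
    have "geg_int d (q * monom 1 l) = 0" if "l < j" for l
      using c(2)[of l] that d by (simp add: q_def sum_distrib_right geg_int_sum geg_int_smult)
    moreover have "q * p = (\<Sum>l\<le>degree p. smult (coeff p l) (q * monom 1 l))"
      by (subst (1) poly_as_sum_of_monoms[of p, symmetric]) (simp add: sum_distrib_left smult_monom flip: mult_smult_right)
    ultimately show ?thesis using d that by (simp add: geg_int_sum geg_int_smult)
  qed
  have "degree q \<le> j" using coeff_q by (intro degree_le) auto
  moreover have "\<not> degree q < j" using orth[of q] geg_int_square_pos[OF d q0] by auto
  ultimately show ?thesis using q0 orth unfolding orth_lower_def by (intro exI[of _ q]) auto
qed

text \<open>If \<open>q 1 = 0\<close> then \<open>q = (1 - s) r\<close> would be orthogonal to \<open>r\<close>, although \<open>(1 - s) r\<^sup>2 \<ge> 0\<close>.\<close>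
lemma orth_lower_poly_1:
  assumes d: "d \<ge> 2" and q: "orth_lower d j q"
  shows "poly q 1 \<noteq> 0"
proof
  assume "poly q 1 = 0"
  then obtain r0 where r0: "q = [:- 1, 1:] * r0"
    unfolding poly_eq_0_iff_dvd by (rule dvdE)
  define r where "r = - r0"
  have r: "q = [:1, -1:] * r" by (simp add: r0 r_def)
  have "q \<noteq> 0" using q by (simp add: orth_lower_def)
  then have "r \<noteq> 0" using r by auto
  have "degree q = degree [:1, -1::real:] + degree r"
    unfolding r by (rule degree_mult_eq) (use \<open>r \<noteq> 0\<close> in auto)
  then have "degree r < degree q" by simp
  then have "geg_int d (q * r) = 0" using q by (auto simp: orth_lower_def)
  moreover have "geg_int d (q * r) > 0"
    using d
  proof (rule geg_int_pos)
    show "q * r \<noteq> 0" using \<open>r \<noteq> 0\<close> \<open>q \<noteq> 0\<close> by simp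
    show "0 \<le> poly (q * r) s" if "\<bar>s\<bar> \<le> 1" for s
    proof -
      have "poly (q * r) s = (1 - s) * (poly r s)\<^sup>2" by (simp add: r power2_eq_square algebra_simps)
      then show ?thesis using that by simp
    qed
  qed
  ultimately show False by simp
qed

lemma orth_lower_unique:
  assumes d: "d \<ge> 2" and q: "orth_lower d j q" and q': "orth_lower d j q'" and eq: "poly q 1 = poly q' 1"
  shows "q = q'"
proof -
  \<comment> \<open>The leading terms cancel, so a nonzero \<open>r\<close> would have degree below
    \<open>j\<close> and be orthogonal to \<open>q\<close>, to \<open>q'\<close> and thus to
    itself.\<close>
  define r where "r = smult (lead_coeff q') q - smult (lead_coeff q) q'"
  have "r = 0"
  proof (rule ccontr)
    assume "r \<noteq> 0"
    have "degree r \<le> j" "coeff r j = 0"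
      using q q' by (auto simp: r_def orth_lower_def intro!: degree_diff_le)
    then have "degree r < j" using \<open>r \<noteq> 0\<close> by (metis leading_coeff_0_iff le_neq_implies_less)
    then have "geg_int d (q * r) = 0" "geg_int d (q' * r) = 0" using q q' by (auto simp: orth_lower_def)
    moreover have "r * r = smult (lead_coeff q') (q * r) - smult (lead_coeff q) (q' * r)"
      by (subst (1) r_def) (simp add: algebra_simps)
    ultimately have "geg_int d (r * r) = 0" using d by (simp add: geg_int_diff geg_int_smult)
    then show False using geg_int_square_pos[OF d \<open>r \<noteq> 0\<close>] by simp
  qed
  then have *: "smult (lead_coeff q') q = smult (lead_coeff q) q'" by (simp add: r_def)
  from arg_cong[OF this, of "\<lambda>p. poly p 1"] have "lead_coeff q = lead_coeff q'"
    using eq orth_lower_poly_1[OF d q] by simp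
  moreover have "lead_coeff q \<noteq> 0" using q by (auto simp: orth_lower_def)
  ultimately show ?thesis using * by (metis smult_cancel)
qed

text \<open>With a vanishing dimension no family would meet the description in \<open>gegenbauer\<close>, because
  orthogonality excludes \<open>Q\<^sub>j 1 = 0\<close>.\<close>
lemma gegenbauer_orth_lower:
  assumes d: "CARD('n::finite) \<ge> 2" and dim: "\<And>j. dim_Harm TYPE('n) j \<noteq> 0"
  shows "orth_lower CARD('n) j (gegenbauer TYPE('n) j)"
proof -
  let ?d = "CARD('n)" and ?T = "TYPE('n)"
  define S where "S = (\<lambda>Q. \<forall>j. degree (Q j) = j \<and>
     (\<forall>k. k \<noteq> j \<longrightarrow> gegenbauer_inner ?T (Q j) (Q k) = 0) \<and> poly (Q j) 1 = real (dim_Harm ?T j))"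
  have S_orth: "orth_lower ?d j (Q j)" if "S Q" for Q j
  proof -
    \<comment> \<open>The zero polynomial has degree 0 as well; the nonzero value at 1 excludes
      it.\<close>
    have Q: "degree (Q k) = k" "Q k \<noteq> 0" for k
      using that dim[of k] unfolding S_def by (auto dest: spec[of _ k])
    have "geg_int ?d (Q j * p) = 0" if p: "degree p < j" for p
    proof -
      have deg: "degree p \<le> j - 1" using p by simp
      show ?thesis
      proof (rule poly_graded_induct[where R = "\<lambda>p. geg_int ?d (Q j * p) = 0", OF _ deg])
        fix k assume "k \<le> j - 1"
        then have "k \<noteq> j" using p by auto
        then show "geg_int ?d (Q j * Q k) = 0"
          using \<open>S Q\<close> by (simp add: S_def gegenbauer_inner_eq)
      qed (use d Q in \<open>auto simp: distrib_left geg_int_add geg_int_smult\<close>)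
    qed
    then show ?thesis using Q by (simp add: orth_lower_def)
  qed
  obtain q where q: "\<And>j. orth_lower ?d j (q j)" using orth_lower_exists[OF d] by metis
  define Q where "Q = (\<lambda>j. smult (real (dim_Harm ?T j) / poly (q j) 1) (q j))"
  have "S Q"
    unfolding S_def
  proof (intro allI conjI impI)
    fix j
    show "degree (Q j) = j" "poly (Q j) 1 = real (dim_Harm ?T j)"
      using q[of j] orth_lower_poly_1[OF d q[of j]] dim[of j] by (auto simp: Q_def orth_lower_def)
    fix k assume "k \<noteq> j"
    then have "geg_int ?d (q j * q k) = 0"
      using q[of j] q[of k] unfolding orth_lower_def by (metis linorder_neqE_nat mult.commute)
    then show "gegenbauer_inner ?T (Q j) (Q k) = 0"
      by (simp add: gegenbauer_inner_eq Q_def geg_int_smult)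
  qed
  moreover have "Q' = Q''" if "S Q'" "S Q''" for Q' Q''
    using orth_lower_unique[OF d S_orth[OF that(1)] S_orth[OF that(2)]] that by (auto simp: S_def)
  ultimately have "S (THE Q. S Q)" by (intro theI'[of S]) blast
  then show ?thesis using S_orth[of "gegenbauer ?T"] by (simp add: gegenbauer_def S_def)
qed

section \<open>The dimension of the space of harmonic polynomials\<close>

definition mon :: "('n::finite \<Rightarrow> nat) \<Rightarrow> real ^ 'n \<Rightarrow> real" where
  "mon \<alpha> x = (\<Prod>i\<in>UNIV. (x $ i) ^ \<alpha> i)"

lemma mon_add: "mon (\<lambda>i. \<alpha> i + \<beta> i) x = mon \<alpha> x * mon \<beta> x"
  by (simp add: mon_def power_add prod.distrib)

lemma mon_scaleR: "mon \<alpha> (c *\<^sub>R x) = c ^ sum \<alpha> UNIV * mon \<alpha> x"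
  by (simp add: mon_def power_mult_distrib prod.distrib power_sum)

lemma sum_fun_apply: "(\<Sum>a\<in>A. f a) x = (\<Sum>a\<in>A. f a x :: real)"
  by (induction A rule: infinite_finite_induct) auto

text \<open>The scalar multiplication is the one in \<open>dim_Harm\<close>, so general dimension
  theory applies to it directly.\<close>

interpretation fun_space: vector_space "\<lambda>(c::real) (f :: real ^ 'n \<Rightarrow> real) x. c * f x"
  by unfold_locales (auto simp: fun_eq_iff algebra_simps)

section \<open>Polynomial functions as combinations of monomials\<close>

lemma bounded_linear_coord_expansion:
  fixes f :: "real ^ 'n::finite \<Rightarrow> real"
  assumes "bounded_linear f"
  shows "f x = (\<Sum>i\<in>UNIV. f (axis i 1) * x $ i)"
proof -
  have "(\<Sum>i\<in>UNIV. x $ i *\<^sub>R axis i 1) = x"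
    using basis_expansion[of x] by (simp only: scalar_mult_eq_scaleR)
  then have "f x = f (\<Sum>i\<in>UNIV. x $ i *\<^sub>R axis i 1)" by (simp only:)
  also have "\<dots> = (\<Sum>i\<in>UNIV. f (x $ i *\<^sub>R axis i 1))"
    using bounded_linear.linear[OF assms] by (rule linear_sum)
  also have "\<dots> = (\<Sum>i\<in>UNIV. f (axis i 1) * x $ i)"
    by (intro sum.cong refl) (simp add: linear_scale[OF bounded_linear.linear[OF assms]])
  finally show ?thesis .
qed

lemma coord_in_range_mon: "(\<lambda>x :: real^'n. x $ i) \<in> range mon"
proof (rule range_eqI)
  have "x $ k ^ (if k = i then 1 else 0) = (if k = i then x $ k else 1)" for k and x :: "real^'n"
    by simp
  then show "(\<lambda>x. x $ i) = mon (\<lambda>k. if k = i then 1 else 0)"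
    by (simp add: mon_def fun_eq_iff)
qed

lemma real_polynomial_function_span_mon:
  assumes "real_polynomial_function (f :: real ^ 'n \<Rightarrow> real)"
  shows "f \<in> fun_space.span (range mon)"
  using assms
proof induction
  case (linear f)
  have "(\<Sum>i\<in>UNIV. (\<lambda>x. f (axis i 1) * x $ i)) = f"
    by (rule ext) (simp only: sum_fun_apply bounded_linear_coord_expansion[OF linear, symmetric])
  moreover have "(\<Sum>i\<in>UNIV. (\<lambda>x. f (axis i 1) * x $ i)) \<in> fun_space.span (range mon)"
    by (intro fun_space.span_sum fun_space.span_scale fun_space.span_base coord_in_range_mon)
  ultimately show ?case by (simp only:)
next
  case (const c)
  have "(\<lambda>x :: real^'n. c * mon (\<lambda>_. 0) x) \<in> fun_space.span (range mon)"
    by (intro fun_space.span_scale fun_space.span_base) auto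
  moreover have "mon (\<lambda>_. 0) = (\<lambda>_ :: real^'n. 1)" by (simp add: mon_def fun_eq_iff)
  ultimately show ?case by simp
next
  case (add f g)
  then show ?case using fun_space.span_add[of f _ g] by (simp add: plus_fun_def)
next
  case (mult f g)
  \<comment> \<open>Products are expanded one factor at a time, first \<open>g\<close> against a
    single monomial.\<close>
  have mono: "(\<lambda>x. mon \<alpha> x * g x) \<in> fun_space.span (range mon)" for \<alpha>
    using mult.IH(2)
  proof (induction rule: fun_space.span_induct_alt)
    case base
    show ?case using fun_space.span_zero by (simp add: zero_fun_def)
  next
    case (step c h h')
    then obtain \<beta> where h: "h = mon \<beta>" by auto
    have "(\<lambda>x. mon \<alpha> x * ((\<lambda>x. c * h x) + h') x)
      = (\<lambda>x. c * mon (\<lambda>i. \<alpha> i + \<beta> i) x) + (\<lambda>x. mon \<alpha> x * h' x)"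
      by (auto simp: fun_eq_iff h mon_add algebra_simps)
    then show ?case
      using fun_space.span_add[OF fun_space.span_scale[OF fun_space.span_base[OF rangeI]] step.IH(1)]
      by simp
  qed
  show ?case
    using mult.IH(1)
  proof (induction rule: fun_space.span_induct_alt)
    case base
    show ?case using fun_space.span_zero by (simp add: zero_fun_def)
  next
    case (step c h h')
    then obtain \<beta> where h: "h = mon \<beta>" by auto
    have "(\<lambda>x. ((\<lambda>x. c * h x) + h') x * g x)
      = (\<lambda>x. c * (\<lambda>x. mon \<beta> x * g x) x) + (\<lambda>x. h' x * g x)"
      by (auto simp: fun_eq_iff h algebra_simps)
    then show ?case
      using fun_space.span_add[OF fun_space.span_scale[OF mono] step.IH(1)]
      by simp
  qed
qed

text \<open>For fixed \<open>x\<close>, compare coefficients of \<open>c ^ j\<close> in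
  \<open>f (c *\<^sub>R x)\<close> as a polynomial in \<open>c\<close>. The result makes
  \<open>Harm j\<close> finite-dimensional.\<close>

lemma homogeneous_span_mon:
  assumes "real_polynomial_function (f :: real ^ 'n \<Rightarrow> real)"
    and hom: "\<And>c x. f (c *\<^sub>R x) = c ^ j * f x"
  shows "f \<in> fun_space.span (mon ` expts j)"
proof -
  obtain t r where t: "finite t" "t \<subseteq> range mon" and f: "f = (\<Sum>g\<in>t. (\<lambda>x. r g * g x))"
    using real_polynomial_function_span_mon[OF assms(1)] unfolding fun_space.span_explicit by blast
  from t(2) have "\<forall>g\<in>t. \<exists>\<alpha>. g = mon \<alpha>" by auto
  then obtain a where a: "\<forall>g\<in>t. g = mon (a g)" by metis
  define deg where "deg = (\<lambda>g. sum (a g) UNIV)"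
  have f': "f x = (\<Sum>g\<in>t. r g * g x)" for x
    by (subst f) (simp add: sum_fun_apply)
  have g_scale: "g (c *\<^sub>R x) = c ^ deg g * g x" if "g \<in> t" for g c x
    using a that mon_scaleR[of "a g"] unfolding deg_def by metis
  have "f x = (\<Sum>g\<in>{g\<in>t. deg g = j}. r g * g x)" for x
  proof -
    have "(\<Sum>g\<in>t. monom (r g * g x) (deg g)) = monom (f x) j"
    proof (rule poly_ext)
      fix c
      have "f (c *\<^sub>R x) = (\<Sum>g\<in>t. r g * (c ^ deg g * g x))"
        unfolding f' by (intro sum.cong refl) (simp add: g_scale)
      then show "poly (\<Sum>g\<in>t. monom (r g * g x) (deg g)) c = poly (monom (f x) j) c"
        by (simp add: hom poly_sum poly_monom mult_ac)
    qed
    from arg_cong[OF this, of "\<lambda>p. coeff p j"] have "f x = (\<Sum>g\<in>t. if deg g = j then r g * g x else 0)"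
      by (simp add: coeff_sum)
    then show ?thesis using t(1) by (simp add: sum.If_cases Int_def)
  qed
  then have "f = (\<Sum>g\<in>{g\<in>t. deg g = j}. (\<lambda>x. r g * g x))"
    by (simp add: fun_eq_iff sum_fun_apply)
  also have "\<dots> \<in> fun_space.span (mon ` expts j)"
  proof (intro fun_space.span_sum fun_space.span_scale fun_space.span_base)
    fix g assume "g \<in> {g\<in>t. deg g = j}"
    then have "g = mon (a g)" "a g \<in> expts j" using a by (auto simp: deg_def expts_def)
    then show "g \<in> mon ` expts j" by blast
  qed
  finally show ?thesis .
qed

section \<open>Harmonic polynomials from complex powers\<close>

text \<open>The prefactor \<open>c\<close> permits a second application to the derivative. For
  \<open>n = 0\<close> the truncated exponent is harmless because the factor \<open>of_nat n\<close>
  is 0.\<close>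

lemma Re_power_deriv:
  "deriv (\<lambda>s. Re (c * (z + of_real s * w) ^ n)) = (\<lambda>s. Re (c * of_nat n * w * (z + of_real s * w) ^ (n - 1)))"
proof
  fix s :: real
  have "((\<lambda>s. c * (z + s * w) ^ n) has_field_derivative c * of_nat n * w * (z + of_real s * w) ^ (n - 1))
          (at (of_real s))"
    by (auto intro!: derivative_eq_intros)
  from bounded_linear.has_vector_derivative[OF bounded_linear_Re has_vector_derivative_real_field[OF this]]
  have "((\<lambda>s. Re (c * (z + of_real s * w) ^ n)) has_real_derivative
      Re (c * of_nat n * w * (z + of_real s * w) ^ (n - 1))) (at s)"
    by (simp add: has_real_derivative_iff_has_vector_derivative)
  then show "deriv (\<lambda>s. Re (c * (z + of_real s * w) ^ n)) s = Re (c * of_nat n * w * (z + of_real s * w) ^ (n - 1))"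
    by (rule DERIV_imp_deriv)
qed

lemma Re_power_Harm:
  fixes a b :: "'n::finite"
  assumes ab: "a \<noteq> b"
  shows "(\<lambda>x. Re (Complex (x $ a) (x $ b) ^ j)) \<in> Harm j"
proof -
  have poly: "real_polynomial_function (\<lambda>x::real^'n. Re (Complex (x $ a) (x $ b) ^ k)) \<and>
        real_polynomial_function (\<lambda>x::real^'n. Im (Complex (x $ a) (x $ b) ^ k))" for k
  proof (induction k)
    case 0
    show ?case by (auto intro: real_polynomial_function.intros)
  next
    case (Suc k)
    have "real_polynomial_function (\<lambda>x::real^'n. x $ i)" for i
      by (intro real_polynomial_function.intros(1) bounded_linear_vec_nth)
    with Suc show ?case
      by (auto intro!: real_polynomial_function.intros(3,4) real_polynomial_function_diff)
  qed
  have hom: "Re (Complex ((c *\<^sub>R x) $ a) ((c *\<^sub>R x) $ b) ^ j) = c ^ j * Re (Complex (x $ a) (x $ b) ^ j)"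
    for c and x :: "real^'n"
  proof -
    have "Complex ((c *\<^sub>R x) $ a) ((c *\<^sub>R x) $ b) = c *\<^sub>R Complex (x $ a) (x $ b)"
      by (simp add: complex_eq_iff)
    then show ?thesis by (simp only: scaleR_power scaleR_complex.sel)
  qed
  have lap: "laplacian (\<lambda>x. Re (Complex (x $ a) (x $ b) ^ j)) x = 0" for x :: "real^'n"
  proof -
    define z where "z = Complex (x $ a) (x $ b)"
    \<comment> \<open>The complex argument moves in direction \<open>w i\<close> along axis
      \<open>i\<close>. Harmonicity comes from \<open>1 + \<i>^2 = 0\<close>, the sum of the squares
      of these directions.\<close>
    define w :: "'n \<Rightarrow> complex" where "w = (\<lambda>i. if i = a then 1 else if i = b then \<i> else 0)"
    have line: "Complex ((x + s *\<^sub>R axis i 1) $ a) ((x + s *\<^sub>R axis i 1) $ b) = z + of_real s * w i" for s i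
      using ab by (auto simp: z_def w_def axis_def complex_eq_iff)
    have "(deriv ^^ 2) (\<lambda>s. Re (Complex ((x + s *\<^sub>R axis i 1) $ a) ((x + s *\<^sub>R axis i 1) $ b) ^ j)) 0 =
       Re (of_nat j * of_nat (j - 1) * z ^ (j - 2) * (w i)\<^sup>2)" for i
      unfolding line numeral_2_eq_2
      using Re_power_deriv[of 1 z "w i" j] Re_power_deriv[of "of_nat j * w i" z "w i" "j - 1"]
      by (simp add: mult_ac)
    then have "laplacian (\<lambda>x. Re (Complex (x $ a) (x $ b) ^ j)) x =
        Re (of_nat j * of_nat (j - 1) * z ^ (j - 2) * (\<Sum>i\<in>UNIV. (w i)\<^sup>2))"
      by (simp add: laplacian_def sum_distrib_left)
    also have "(\<Sum>i\<in>UNIV. (w i)\<^sup>2) = (\<Sum>i\<in>{a, b}. (w i)\<^sup>2)"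
      by (rule sum.mono_neutral_right) (auto simp: w_def)
    also have "\<dots> = 0" using ab by (simp add: w_def)
    finally show ?thesis by simp
  qed
  show ?thesis using poly hom lap unfolding Harm_def by blast
qed

text \<open>A nonzero element alone is not enough: \<open>dim\<close> is the cardinality of a basis
  and \<open>card\<close> of an infinite set is 0, so finite dimension is needed too.\<close>

lemma dim_Harm_nonzero:
  assumes "CARD('n::finite) \<ge> 2"
  shows "dim_Harm TYPE('n) j \<noteq> 0"
proof -
  have "\<not> card (UNIV :: 'n set) \<le> Suc 0" using assms by simp
  then obtain a b :: 'n where "a \<noteq> b" by (auto simp: card_le_Suc0_iff_eq)
  define h :: "real^'n \<Rightarrow> real" where "h = (\<lambda>x. Re (Complex (x $ a) (x $ b) ^ j))"
  have h: "h \<in> Harm j" unfolding h_def by (rule Re_power_Harm) fact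
  have "h (axis a 1) = 1" using \<open>a \<noteq> b\<close> by (simp add: h_def axis_def Complex_eq)
  then have "h \<noteq> 0" by auto
  obtain B where B: "B \<subseteq> (Harm j :: (real^'n \<Rightarrow> real) set)" "fun_space.independent B" "Harm j \<subseteq> fun_space.span B" "card B = fun_space.dim (Harm j :: (real^'n \<Rightarrow> real) set)"
    by (rule fun_space.basis_exists[of "Harm j"])
  have "Harm j \<subseteq> fun_space.span (mon ` expts j)"
    by (auto simp: Harm_def intro: homogeneous_span_mon)
  then have "finite B"
    using fun_space.independent_span_bound[of "mon ` expts j" B] B by auto
  moreover have "B \<noteq> {}" using B(3) h \<open>h \<noteq> 0\<close> by auto
  ultimately have "card B \<noteq> 0" by simp
  then show ?thesis unfolding dim_Harm_def B(4)[symmetric] .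
qed

section \<open>Moments of a design\<close>

lemma sum_expts_mon_mon:
  "(\<Sum>\<alpha>\<in>expts k. mon \<alpha> x * mon \<alpha> y / (\<Prod>i\<in>UNIV. fact (\<alpha> i))) = (x \<bullet> y) ^ k / fact k"
  using multinomial_UNIV[of "\<lambda>i. x $ i * y $ i" k]
  by (simp add: mon_def inner_vec_def prod_dividef power_mult_distrib prod.distrib)

text \<open>\<open>sph_mom \<alpha>\<close> is the mean value of \<open>mon \<alpha>\<close> on the unit sphere.\<close>
definition sph_mom :: "('n::finite \<Rightarrow> nat) \<Rightarrow> real" where
  "sph_mom \<alpha> = (\<Prod>i\<in>UNIV. gmom (\<alpha> i)) / chi_mom CARD('n) (sum \<alpha> UNIV)"

text \<open>The mean of \<open>(x \<bullet> y) ^ k / fact k\<close> over \<open>y\<close> in the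
  sphere does not depend on the unit vector \<open>x\<close>. It follows from
  \<open>sum_expts_gmom\<close>, as \<open>chi_mom\<close> is constant on
  \<open>expts k\<close>.\<close>

lemma sum_expts_mon_sph_mom:
  fixes x :: "real ^ 'n::finite"
  assumes d: "CARD('n) \<ge> 2" and x: "norm x = 1"
  shows "(\<Sum>\<alpha>\<in>expts k. mon \<alpha> x * sph_mom \<alpha> / (\<Prod>i\<in>UNIV. fact (\<alpha> i))) = geg_mom CARD('n) k / fact k"
proof -
  have "(\<Sum>i\<in>UNIV. (x $ i)\<^sup>2) = (norm x)\<^sup>2"
    unfolding power2_norm_eq_inner by (simp add: inner_vec_def power2_eq_square)
  then have "(\<Sum>\<alpha>\<in>expts k. \<Prod>i\<in>UNIV. (x $ i) ^ \<alpha> i * gmom (\<alpha> i) / fact (\<alpha> i)) = gmom k / fact k"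
    using x by (intro sum_expts_gmom) simp
  then have "(\<Sum>\<alpha>\<in>expts k. mon \<alpha> x * (\<Prod>i\<in>UNIV. gmom (\<alpha> i)) / (\<Prod>i\<in>UNIV. fact (\<alpha> i))) = gmom k / fact k"
    by (simp add: mon_def prod_dividef prod.distrib)
  then have "(\<Sum>\<alpha>\<in>expts k. mon \<alpha> x * (\<Prod>i\<in>UNIV. gmom (\<alpha> i)) / (\<Prod>i\<in>UNIV. fact (\<alpha> i))) / chi_mom CARD('n) k
      = gmom k / fact k / chi_mom CARD('n) k" by (rule arg_cong)
  moreover have "(\<Sum>\<alpha>\<in>expts k. mon \<alpha> x * (\<Prod>i\<in>UNIV. gmom (\<alpha> i)) / (\<Prod>i\<in>UNIV. fact (\<alpha> i))) / chi_mom CARD('n) k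
      = (\<Sum>\<alpha>\<in>expts k. mon \<alpha> x * sph_mom \<alpha> / (\<Prod>i\<in>UNIV. fact (\<alpha> i)))"
    unfolding sum_divide_distrib
    by (intro sum.cong refl) (simp add: sph_mom_def expts_def field_simps)
  ultimately show ?thesis by (simp add: geg_mom_eq[OF d])
qed

text \<open>The same mean with \<open>x\<close> averaged as well; one of the two factors
  \<open>chi_mom\<close> cancels.\<close>

lemma sum_expts_sph_mom_square:
  assumes d: "CARD('n::finite) \<ge> 2"
  shows "(\<Sum>\<alpha>\<in>(expts k :: ('n \<Rightarrow> nat) set). (sph_mom \<alpha>)\<^sup>2 / (\<Prod>i\<in>UNIV. fact (\<alpha> i))) = geg_mom CARD('n) k / fact k"
proof -
  let ?c = "chi_mom CARD('n) k"
  have c: "?c > 0" by (simp add: chi_mom_pos)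
  have "(\<Sum>\<alpha>\<in>(expts k :: ('n \<Rightarrow> nat) set). (sph_mom \<alpha>)\<^sup>2 / (\<Prod>i\<in>UNIV. fact (\<alpha> i)))
     = (\<Sum>\<alpha>\<in>(expts k :: ('n \<Rightarrow> nat) set). \<Prod>i\<in>UNIV. (gmom (\<alpha> i))\<^sup>2 / fact (\<alpha> i)) / ?c\<^sup>2"
    unfolding sum_divide_distrib
    by (intro sum.cong refl) (simp add: sph_mom_def expts_def prod_dividef prod_power_distrib power_divide)
  also have "\<dots> = geg_mom CARD('n) k / fact k"
    unfolding sum_expts_gmom_square geg_mom_eq[OF d] using c by (simp add: power2_eq_square)
  finally show ?thesis .
qed

text \<open>Both sides are linear in the polynomial replacing \<open>s ^ k\<close>, so Gegenbauer
  polynomials suffice. For \<open>j \<ge> 1\<close> the left side vanishes by \<open>des\<close> and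
  the right side by orthogonality to constants.\<close>

lemma design_kernel:
  fixes X :: "(real ^ 'n::finite) set" and a :: "real ^ 'n \<Rightarrow> real"
  assumes d: "CARD('n) \<ge> 2"
    and des: "\<And>j. j \<in> {1..t} \<Longrightarrow>
      (\<Sum>x\<in>X. \<Sum>y\<in>X. a x * a y * poly (gegenbauer TYPE('n) j) (sgn x \<bullet> sgn y)) = 0"
    and "k \<le> t"
  shows "(\<Sum>x\<in>X. \<Sum>y\<in>X. a x * a y * (sgn x \<bullet> sgn y) ^ k) = (sum a X)\<^sup>2 * geg_mom CARD('n) k"
proof -
  let ?d = "CARD('n)" and ?Q = "gegenbauer TYPE('n)"
  define K where "K = (\<lambda>p. \<Sum>x\<in>X. \<Sum>y\<in>X. a x * a y * poly p (sgn x \<bullet> sgn y))"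
  have Q: "orth_lower ?d j (?Q j)" for j
    using gegenbauer_orth_lower[OF d dim_Harm_nonzero[OF d]] .
  have "K p * geg_int ?d 1 = (sum a X)\<^sup>2 * geg_int ?d p" if p: "degree p \<le> t" for p
  proof (rule poly_graded_induct[where Q = ?Q, OF _ p])
    show "degree (?Q j) = j \<and> ?Q j \<noteq> 0" for j using Q[of j] by (simp add: orth_lower_def)
    show "K (p + q) * geg_int ?d 1 = (sum a X)\<^sup>2 * geg_int ?d (p + q)"
      if "K p * geg_int ?d 1 = (sum a X)\<^sup>2 * geg_int ?d p" "K q * geg_int ?d 1 = (sum a X)\<^sup>2 * geg_int ?d q"
      for p q
    proof -
      have "K (p + q) = K p + K q" by (simp add: K_def distrib_left sum.distrib)
      then show ?thesis using that by (simp add: geg_int_add[OF d] distrib_left distrib_right)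
    qed
    show "K (smult c p) * geg_int ?d 1 = (sum a X)\<^sup>2 * geg_int ?d (smult c p)"
      if "K p * geg_int ?d 1 = (sum a X)\<^sup>2 * geg_int ?d p" for c p
    proof -
      have "K (smult c p) = c * K p" by (simp add: K_def sum_distrib_left mult_ac)
      then show ?thesis using that by (simp add: geg_int_smult)
    qed
    show "K (?Q j) * geg_int ?d 1 = (sum a X)\<^sup>2 * geg_int ?d (?Q j)" if "j \<le> t" for j
    proof (cases "j = 0")
      case True
      then have "degree (?Q j) = 0" using Q[of j] by (simp add: orth_lower_def)
      then obtain c where c: "?Q j = smult c 1" by (auto elim: degree_eq_zeroE)
      have "K (?Q j) = (sum a X)\<^sup>2 * c"
        unfolding c K_def power2_eq_square sum_product by (simp add: sum_distrib_right)
      then show ?thesis unfolding c by (simp only: geg_int_smult mult.assoc)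
    next
      case False
      then have "geg_int ?d (?Q j * 1) = 0" using Q[of j] unfolding orth_lower_def by (metis degree_1 neq0_conv)
      moreover have "K (?Q j) = 0" unfolding K_def using False that by (intro des) simp
      ultimately show ?thesis by simp
    qed
  qed
  from this[of "monom 1 k"] have "K (monom 1 k) * geg_int ?d 1 = (sum a X)\<^sup>2 * geg_int ?d (monom 1 k)"
    using \<open>k \<le> t\<close> by (simp add: degree_monom_eq)
  moreover have "geg_int ?d 1 > 0" using d by (intro geg_int_pos) auto
  ultimately have "K (monom 1 k) = (sum a X)\<^sup>2 * geg_mom ?d k"
    by (simp add: geg_mom_def field_simps)
  then show ?thesis by (simp add: K_def poly_monom)
qed

text \<open>The squared deviations of the moments from those of the sphere, weighted by the
  multinomial coefficients, add up to \<open>K - 2 K + K = 0\<close>.\<close>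
lemma design_moments:
  fixes X :: "(real ^ 'n::finite) set" and a :: "real ^ 'n \<Rightarrow> real"
  assumes d: "CARD('n) \<ge> 2" and X: "0 \<notin> X"
    and des: "\<And>j. j \<in> {1..t} \<Longrightarrow>
      (\<Sum>x\<in>X. \<Sum>y\<in>X. a x * a y * poly (gegenbauer TYPE('n) j) (sgn x \<bullet> sgn y)) = 0"
    and \<alpha>: "sum \<alpha> UNIV \<le> t"
  shows "(\<Sum>x\<in>X. a x * mon \<alpha> (sgn x)) = sum a X * sph_mom \<alpha>"
proof -
  define k where "k = sum \<alpha> UNIV"
  define A where "A = sum a X"
  define \<mu> where "\<mu> = geg_mom CARD('n) k / fact k"
  define W where "W = (\<lambda>\<beta> :: 'n \<Rightarrow> nat. \<Prod>i\<in>UNIV. fact (\<beta> i) :: real)"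
  define S where "S = (\<lambda>\<beta>. \<Sum>x\<in>X. a x * mon \<beta> (sgn x))"
  have W: "W \<beta> > 0" for \<beta> by (auto simp: W_def intro: prod_pos)
  have unit: "norm (sgn x) = 1" if "x \<in> X" for x using X that by (auto simp: norm_sgn)
  have "(\<Sum>\<beta>\<in>expts k. (S \<beta>)\<^sup>2 / W \<beta>)
      = (\<Sum>\<beta>\<in>expts k. \<Sum>x\<in>X. \<Sum>y\<in>X. a x * a y * (mon \<beta> (sgn x) * mon \<beta> (sgn y) / W \<beta>))"
    by (simp add: S_def power2_eq_square sum_product sum_divide_distrib mult_ac)
  also have "\<dots> = (\<Sum>x\<in>X. \<Sum>\<beta>\<in>expts k. \<Sum>y\<in>X. a x * a y * (mon \<beta> (sgn x) * mon \<beta> (sgn y) / W \<beta>))"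
    by (rule sum.swap)
  also have "\<dots> = (\<Sum>x\<in>X. \<Sum>y\<in>X. \<Sum>\<beta>\<in>expts k. a x * a y * (mon \<beta> (sgn x) * mon \<beta> (sgn y) / W \<beta>))"
    by (intro sum.cong refl sum.swap)
  also have "\<dots> = (\<Sum>x\<in>X. \<Sum>y\<in>X. a x * a y * ((sgn x \<bullet> sgn y) ^ k / fact k))"
    unfolding sum_distrib_left[symmetric] W_def sum_expts_mon_mon ..
  also have "\<dots> = (\<Sum>x\<in>X. \<Sum>y\<in>X. a x * a y * (sgn x \<bullet> sgn y) ^ k) / fact k"
    by (simp add: sum_divide_distrib)
  also have "\<dots> = A\<^sup>2 * \<mu>"
    using design_kernel[OF d des, of k] \<alpha> by (simp add: \<mu>_def A_def k_def)
  finally have SS: "(\<Sum>\<beta>\<in>expts k. (S \<beta>)\<^sup>2 / W \<beta>) = A\<^sup>2 * \<mu>" .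
  have "(\<Sum>\<beta>\<in>expts k. S \<beta> * sph_mom \<beta> / W \<beta>)
      = (\<Sum>\<beta>\<in>expts k. \<Sum>x\<in>X. a x * (mon \<beta> (sgn x) * sph_mom \<beta> / W \<beta>))"
    unfolding S_def sum_distrib_right sum_divide_distrib by (simp add: mult.assoc)
  also have "\<dots> = (\<Sum>x\<in>X. \<Sum>\<beta>\<in>expts k. a x * (mon \<beta> (sgn x) * sph_mom \<beta> / W \<beta>))"
    by (rule sum.swap)
  also have "\<dots> = (\<Sum>x\<in>X. a x * \<mu>)"
    unfolding sum_distrib_left[symmetric] W_def \<mu>_def
    by (intro sum.cong refl arg_cong2[where f = "(*)"] sum_expts_mon_sph_mom[OF d unit])
  also have "\<dots> = A * \<mu>"
    by (simp add: A_def sum_distrib_right)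
  finally have ST: "(\<Sum>\<beta>\<in>expts k. S \<beta> * sph_mom \<beta> / W \<beta>) = A * \<mu>" .
  have TT: "(\<Sum>\<beta>\<in>expts k. (sph_mom \<beta>)\<^sup>2 / W \<beta>) = \<mu>"
    unfolding \<mu>_def W_def by (rule sum_expts_sph_mom_square[OF d])
  have "(\<Sum>\<beta>\<in>expts k. (S \<beta> - A * sph_mom \<beta>)\<^sup>2 / W \<beta>)
     = (\<Sum>\<beta>\<in>expts k. (S \<beta>)\<^sup>2 / W \<beta> - 2 * A * (S \<beta> * sph_mom \<beta> / W \<beta>) + A\<^sup>2 * ((sph_mom \<beta>)\<^sup>2 / W \<beta>))"
    by (intro sum.cong refl)
       (simp add: power2_diff power_mult_distrib add_divide_distrib diff_divide_distrib)
  also have "\<dots> = A\<^sup>2 * \<mu> - 2 * A * (A * \<mu>) + A\<^sup>2 * \<mu>"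
    unfolding sum.distrib sum_subtractf sum_distrib_left[symmetric] SS ST TT ..
  finally have "(\<Sum>\<beta>\<in>expts k. (S \<beta> - A * sph_mom \<beta>)\<^sup>2 / W \<beta>) = 0"
    by (simp add: power2_eq_square)
  then have "\<forall>\<beta>\<in>expts k. (S \<beta> - A * sph_mom \<beta>)\<^sup>2 / W \<beta> = 0"
    using W by (subst (asm) sum_nonneg_eq_0_iff) (auto intro: divide_nonneg_pos)
  moreover have "\<alpha> \<in> expts k" by (simp add: expts_def k_def)
  ultimately have "(S \<alpha> - A * sph_mom \<alpha>)\<^sup>2 / W \<alpha> = 0" by blast
  then show ?thesis using W[of \<alpha>] by (simp add: S_def A_def)
qed

section \<open>Positive definiteness of the spherical moments\<close>

text \<open>The double sum is the spherical mean of the square of the polynomial with coefficients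
  \<open>c\<close>, so definiteness makes the monomials in \<open>M\<close> independent on the
  sphere.\<close>

definition sph_pos_def :: "('n::finite \<Rightarrow> nat) set \<Rightarrow> bool" where
  "sph_pos_def M \<longleftrightarrow> (\<forall>c.
     (\<Sum>\<alpha>\<in>M. \<Sum>\<beta>\<in>M. c \<alpha> * c \<beta> * sph_mom (\<lambda>i. \<alpha> i + \<beta> i)) \<ge> 0 \<and>
     ((\<Sum>\<alpha>\<in>M. \<Sum>\<beta>\<in>M. c \<alpha> * c \<beta> * sph_mom (\<lambda>i. \<alpha> i + \<beta> i)) = 0 \<longrightarrow> (\<forall>\<alpha>\<in>M. c \<alpha> = 0)))"

text \<open>All \<open>\<alpha> + \<beta>\<close> have degree \<open>2 k\<close>, so spherical and
  Gaussian moments differ by one positive constant.\<close>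

lemma sph_pos_def_expts: "sph_pos_def (expts k :: ('n::finite \<Rightarrow> nat) set)"
  unfolding sph_pos_def_def
proof (intro allI)
  fix c :: "('n \<Rightarrow> nat) \<Rightarrow> real"
  let ?c = "chi_mom CARD('n) (k + k)"
  let ?B = "\<Sum>\<alpha>\<in>expts k. \<Sum>\<beta>\<in>expts k. c \<alpha> * c \<beta> * (\<Prod>i\<in>UNIV. gmom (\<alpha> i + \<beta> i))"
  have c: "?c > 0" by (simp add: chi_mom_pos)
  have eq: "(\<Sum>\<alpha>\<in>expts k. \<Sum>\<beta>\<in>expts k. c \<alpha> * c \<beta> * sph_mom (\<lambda>i. \<alpha> i + \<beta> i)) = ?B / ?c"
    unfolding sum_divide_distrib
    by (intro sum.cong refl) (simp add: sph_mom_def expts_def sum.distrib)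
  show "(\<Sum>\<alpha>\<in>expts k. \<Sum>\<beta>\<in>expts k. c \<alpha> * c \<beta> * sph_mom (\<lambda>i. \<alpha> i + \<beta> i)) \<ge> 0 \<and>
     ((\<Sum>\<alpha>\<in>expts k. \<Sum>\<beta>\<in>expts k. c \<alpha> * c \<beta> * sph_mom (\<lambda>i. \<alpha> i + \<beta> i)) = 0 \<longrightarrow> (\<forall>\<alpha>\<in>expts k. c \<alpha> = 0))"
    unfolding eq using c gmom_form_nonneg[of c k] gmom_form_eq_0[of c k] by simp
qed

lemma sph_mom_odd:
  assumes "odd (sum \<alpha> UNIV)"
  shows "sph_mom \<alpha> = 0"
proof -
  have "\<exists>i. odd (\<alpha> i)" using assms by (metis dvd_sum)
  then obtain i where "odd (\<alpha> i)" by blast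
  then have "(\<Prod>i\<in>UNIV. gmom (\<alpha> i)) = 0" using gmom_odd by (auto intro!: prod_zero)
  then show ?thesis by (simp add: sph_mom_def)
qed

text \<open>Monomials of opposite parity are orthogonal on the sphere. This joins the degrees
  \<open>e\<close> and \<open>e - 1\<close>.\<close>

lemma sph_pos_def_Un:
  fixes M N :: "('n::finite \<Rightarrow> nat) set"
  assumes "finite M" "finite N" "sph_pos_def M" "sph_pos_def N"
    and odd: "\<And>\<alpha> \<beta>. \<alpha> \<in> M \<Longrightarrow> \<beta> \<in> N \<Longrightarrow> odd (sum \<alpha> UNIV + sum \<beta> UNIV)"
  shows "sph_pos_def (M \<union> N)"
  unfolding sph_pos_def_def
proof (intro allI)
  fix c :: "('n \<Rightarrow> nat) \<Rightarrow> real"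
  let ?f = "\<lambda>\<alpha> \<beta>. c \<alpha> * c \<beta> * sph_mom (\<lambda>i. \<alpha> i + \<beta> i)"
  define A where "A = (\<Sum>\<alpha>\<in>M. \<Sum>\<beta>\<in>M. ?f \<alpha> \<beta>)"
  define B where "B = (\<Sum>\<alpha>\<in>N. \<Sum>\<beta>\<in>N. ?f \<alpha> \<beta>)"
  have disj: "M \<inter> N = {}" using odd by fastforce
  have cross: "?f \<alpha> \<beta> = 0" "?f \<beta> \<alpha> = 0" if "\<alpha> \<in> M" "\<beta> \<in> N" for \<alpha> \<beta>
  proof -
    have "sph_mom (\<lambda>i. \<alpha> i + \<beta> i) = 0"
      by (rule sph_mom_odd) (use odd[OF that] in \<open>simp add: sum.distrib\<close>)
    then show "?f \<alpha> \<beta> = 0" "?f \<beta> \<alpha> = 0" by (simp_all add: add.commute)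
  qed
  have M: "(\<Sum>\<beta>\<in>M \<union> N. ?f \<alpha> \<beta>) = (\<Sum>\<beta>\<in>M. ?f \<alpha> \<beta>)" if "\<alpha> \<in> M" for \<alpha>
    using assms(1,2) cross(1)[OF that] disj by (intro sum.mono_neutral_right) auto
  have N: "(\<Sum>\<beta>\<in>M \<union> N. ?f \<alpha> \<beta>) = (\<Sum>\<beta>\<in>N. ?f \<alpha> \<beta>)" if "\<alpha> \<in> N" for \<alpha>
    using assms(1,2) cross(2)[OF _ that] disj by (intro sum.mono_neutral_right) auto
  have eq: "(\<Sum>\<alpha>\<in>M \<union> N. \<Sum>\<beta>\<in>M \<union> N. ?f \<alpha> \<beta>) = A + B"
    unfolding A_def B_def sum.union_disjoint[OF assms(1,2) disj, of "\<lambda>\<alpha>. \<Sum>\<beta>\<in>M \<union> N. ?f \<alpha> \<beta>"]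
    by (rule arg_cong2[where f = "(+)"]; rule sum.cong[OF refl]; (rule M | rule N))
  have "A \<ge> 0" "B \<ge> 0" "A = 0 \<longrightarrow> (\<forall>\<alpha>\<in>M. c \<alpha> = 0)" "B = 0 \<longrightarrow> (\<forall>\<alpha>\<in>N. c \<alpha> = 0)"
    using assms(3,4) unfolding sph_pos_def_def A_def B_def by blast+
  then show "(\<Sum>\<alpha>\<in>M \<union> N. \<Sum>\<beta>\<in>M \<union> N. ?f \<alpha> \<beta>) \<ge> 0 \<and>
     ((\<Sum>\<alpha>\<in>M \<union> N. \<Sum>\<beta>\<in>M \<union> N. ?f \<alpha> \<beta>) = 0 \<longrightarrow> (\<forall>\<alpha>\<in>M \<union> N. c \<alpha> = 0))"
    unfolding eq by (auto simp: add_nonneg_eq_0_iff)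
qed

section \<open>The bound\<close>

text \<open>In the antipodal case \<open>Y\<close> is a half of \<open>X\<close>, which suffices because the functions in question
  are all even or all odd.\<close>
lemma design_card_ge:
  fixes X Y :: "(real ^ 'n::finite) set"
  assumes d: "CARD('n) \<ge> 2" and X: "finite X" "0 \<notin> X"
    and w: "\<And>x. x \<in> X \<Longrightarrow> w x > 0"
    and des: "strong_euclidean_design t X w" and t: "2 * e \<le> t"
    and norms: "card (norm ` X) > e"
    and M: "finite M" "\<And>\<alpha>. \<alpha> \<in> M \<Longrightarrow> sum \<alpha> UNIV \<le> e" "sph_pos_def M"
    and Y: "finite Y"
    and det: "\<And>c x. \<lbrakk>\<forall>y\<in>Y. (\<Sum>(i, \<alpha>)\<in>{..e} \<times> M. c (i, \<alpha>) * (norm y ^ i * mon \<alpha> (sgn y))) = 0; x \<in> X\<rbrakk>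
        \<Longrightarrow> (\<Sum>(i, \<alpha>)\<in>{..e} \<times> M. c (i, \<alpha>) * (norm x ^ i * mon \<alpha> (sgn x))) = 0"
  shows "card Y \<ge> (e + 1) * card M"
proof (rule ccontr)
  assume "\<not> card Y \<ge> (e + 1) * card M"
  then have "card Y < card ({..e} \<times> M)" by (simp add: card_cartesian_product)
  with exists_nontrivial_solution[of Y "{..e} \<times> M" "\<lambda>(i, \<alpha>) y. norm y ^ i * mon \<alpha> (sgn y)"] Y M(1)
  obtain c where c: "\<exists>j\<in>{..e} \<times> M. c j \<noteq> 0"
    "\<forall>y\<in>Y. (\<Sum>j\<in>{..e} \<times> M. c j * (case j of (i, \<alpha>) \<Rightarrow> \<lambda>y. norm y ^ i * mon \<alpha> (sgn y)) y) = 0"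
    by auto
  \<comment> \<open>The coefficient of \<open>mon \<alpha>\<close> in the vanishing function, a
    polynomial of degree at most \<open>e\<close> in the radius.\<close>
  define C where "C = (\<lambda>\<alpha> r. \<Sum>i\<le>e. c (i, \<alpha>) * r ^ i)"
  have zero: "(\<Sum>\<alpha>\<in>M. C \<alpha> (norm x) * mon \<alpha> (sgn x)) = 0" if "x \<in> X" for x
  proof -
    have "\<forall>y\<in>Y. (\<Sum>(i, \<alpha>)\<in>{..e} \<times> M. c (i, \<alpha>) * (norm y ^ i * mon \<alpha> (sgn y))) = 0"
      using c(2) by (simp add: case_prod_unfold)
    from det[OF this that] have "(\<Sum>i\<le>e. \<Sum>\<alpha>\<in>M. c (i, \<alpha>) * (norm x ^ i * mon \<alpha> (sgn x))) = 0"
      by (simp add: sum.cartesian_product)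
    then show ?thesis
      unfolding C_def sum_distrib_right by (subst sum.swap) (simp add: mult.assoc)
  qed
  \<comment> \<open>Squaring yields radial powers and monomials of degree at most
    \<open>2 * e\<close>, both within the range \<open>t\<close> of the design.\<close>
  have mom: "(\<Sum>x\<in>X. w x * norm x ^ i * mon (\<lambda>k. \<alpha> k + \<beta> k) (sgn x)) =
      (\<Sum>x\<in>X. w x * norm x ^ i) * sph_mom (\<lambda>k. \<alpha> k + \<beta> k)"
    if "i \<le> e + e" "\<alpha> \<in> M" "\<beta> \<in> M" for i \<alpha> \<beta>
  proof (rule design_moments[OF d X(2)])
    show "sum (\<lambda>k. \<alpha> k + \<beta> k) UNIV \<le> t" using M(2)[OF that(2)] M(2)[OF that(3)] t by (simp add: sum.distrib)
    show "(\<Sum>x\<in>X. \<Sum>y\<in>X. w x * norm x ^ i * (w y * norm y ^ i) *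
       poly (gegenbauer TYPE('n) j) (sgn x \<bullet> sgn y)) = 0" if "j \<in> {1..t}" for j
    proof -
      have "i \<in> {0..t}" using \<open>i \<le> e + e\<close> t by simp
      with des that have "(\<Sum>x\<in>X. \<Sum>y\<in>X. w x * w y * (norm x * norm y) ^ i *
           poly (gegenbauer TYPE('n) j) (sgn x \<bullet> sgn y)) = 0"
        unfolding strong_euclidean_design_def by blast
      then show ?thesis by (simp add: power_mult_distrib mult_ac)
    qed
  qed
  have pair: "(\<Sum>x\<in>X. w x * (C \<alpha> (norm x) * C \<beta> (norm x) * mon (\<lambda>k. \<alpha> k + \<beta> k) (sgn x))) =
      (\<Sum>x\<in>X. w x * (C \<alpha> (norm x) * C \<beta> (norm x) * sph_mom (\<lambda>k. \<alpha> k + \<beta> k)))"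
    if "\<alpha> \<in> M" "\<beta> \<in> M" for \<alpha> \<beta>
  proof -
    have expand: "(\<Sum>x\<in>X. w x * (C \<alpha> (norm x) * C \<beta> (norm x) * f x)) =
       (\<Sum>i\<le>e. \<Sum>j\<le>e. c (i, \<alpha>) * c (j, \<beta>) * (\<Sum>x\<in>X. w x * norm x ^ (i + j) * f x))" for f
    proof -
      have "(\<Sum>x\<in>X. w x * (C \<alpha> (norm x) * C \<beta> (norm x) * f x)) =
         (\<Sum>x\<in>X. \<Sum>i\<le>e. \<Sum>j\<le>e. c (i, \<alpha>) * c (j, \<beta>) * (w x * norm x ^ (i + j) * f x))"
        unfolding C_def sum_product
        by (simp add: sum_distrib_left sum_distrib_right power_add mult_ac)
      also have "\<dots> = (\<Sum>i\<le>e. \<Sum>x\<in>X. \<Sum>j\<le>e. c (i, \<alpha>) * c (j, \<beta>) * (w x * norm x ^ (i + j) * f x))"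
        by (rule sum.swap)
      also have "\<dots> = (\<Sum>i\<le>e. \<Sum>j\<le>e. \<Sum>x\<in>X. c (i, \<alpha>) * c (j, \<beta>) * (w x * norm x ^ (i + j) * f x))"
        by (intro sum.cong refl sum.swap)
      finally show ?thesis by (simp add: sum_distrib_left)
    qed
    show ?thesis
      unfolding expand by (intro sum.cong refl) (simp add: mom that flip: sum_distrib_right)
  qed
  \<comment> \<open>The spherical mean of the squared function with the radius frozen at
    \<open>norm x\<close>.\<close>
  define q where "q = (\<lambda>x :: real^'n. \<Sum>\<alpha>\<in>M. \<Sum>\<beta>\<in>M. C \<alpha> (norm x) * C \<beta> (norm x) * sph_mom (\<lambda>k. \<alpha> k + \<beta> k))"
  have "(\<Sum>x\<in>X. w x * q x) = (\<Sum>\<alpha>\<in>M. \<Sum>\<beta>\<in>M. \<Sum>x\<in>X. w x * (C \<alpha> (norm x) * C \<beta> (norm x) * sph_mom (\<lambda>k. \<alpha> k + \<beta> k)))"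
    unfolding q_def sum_distrib_left by (subst sum.swap) (intro sum.cong refl sum.swap)
  also have "\<dots> = (\<Sum>\<alpha>\<in>M. \<Sum>\<beta>\<in>M. \<Sum>x\<in>X. w x * (C \<alpha> (norm x) * C \<beta> (norm x) * mon (\<lambda>k. \<alpha> k + \<beta> k) (sgn x)))"
    by (intro sum.cong refl pair[symmetric])
  also have "\<dots> = (\<Sum>x\<in>X. w x * (\<Sum>\<alpha>\<in>M. C \<alpha> (norm x) * mon \<alpha> (sgn x))\<^sup>2)"
  proof -
    have "(\<Sum>x\<in>X. w x * (\<Sum>\<alpha>\<in>M. C \<alpha> (norm x) * mon \<alpha> (sgn x))\<^sup>2) =
      (\<Sum>x\<in>X. \<Sum>\<alpha>\<in>M. \<Sum>\<beta>\<in>M. w x * (C \<alpha> (norm x) * C \<beta> (norm x) * mon (\<lambda>k. \<alpha> k + \<beta> k) (sgn x)))"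
      unfolding power2_eq_square sum_product unfolding sum_distrib_left
      by (intro sum.cong refl) (simp add: mon_add mult_ac)
    then show ?thesis by (subst sum.swap) (simp add: sum.swap[of _ M X])
  qed
  also have "\<dots> = 0" using zero by (intro sum.neutral) simp
  finally have sum0: "(\<Sum>x\<in>X. w x * q x) = 0" .
  have q: "q x \<ge> 0 \<and> (q x = 0 \<longrightarrow> (\<forall>\<alpha>\<in>M. C \<alpha> (norm x) = 0))" for x
    using M(3)[unfolded sph_pos_def_def, rule_format, of "\<lambda>\<alpha>. C \<alpha> (norm x)"] unfolding q_def by blast
  have "q x = 0" if "x \<in> X" for x
  proof -
    have "\<And>y. y \<in> X \<Longrightarrow> 0 \<le> w y * q y" using q w by (simp add: less_imp_le)
    then have "w x * q x = 0" using sum0 that X(1) by (simp add: sum_nonneg_eq_0_iff)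
    then show ?thesis using w[OF that] by simp
  qed
  then have C0: "C \<alpha> (norm x) = 0" if "x \<in> X" "\<alpha> \<in> M" for x \<alpha>
    using q[of x] that by blast
  obtain i \<alpha> where i: "i \<le> e" "\<alpha> \<in> M" "c (i, \<alpha>) \<noteq> 0" using c(1) by auto
  \<comment> \<open>\<open>C \<alpha>\<close> as a formal polynomial: nonzero and of degree at most
    \<open>e\<close>, yet every norm of a point of \<open>X\<close> is a root.\<close>
  define p where "p = (\<Sum>i\<le>e. monom (c (i, \<alpha>)) i)"
  have "coeff p i = c (i, \<alpha>)" using i(1) by (simp add: p_def coeff_sum)
  then have "p \<noteq> 0" using i(3) by auto
  have "norm ` X \<subseteq> {r. poly p r = 0}"
    using C0[OF _ i(2)] by (auto simp: p_def C_def poly_sum poly_monom)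
  then have "card (norm ` X) \<le> card {r. poly p r = 0}"
    using poly_roots_finite[OF \<open>p \<noteq> 0\<close>] by (rule card_mono[rotated])
  also have "\<dots> \<le> degree p" using \<open>p \<noteq> 0\<close> by (rule card_poly_roots_bound)
  also have "\<dots> \<le> e" unfolding p_def by (intro degree_sum_le) (auto intro: order_trans[OF degree_monom_le])
  finally show False using norms by simp
qed

lemma antipodal_half:
  fixes X :: "(real ^ 'n::finite) set"
  assumes "finite X" "0 \<notin> X" "X = uminus ` X"
  obtains Y where "Y \<subseteq> X" "card X = 2 * card Y" "\<And>x. x \<in> X \<Longrightarrow> x \<in> Y \<or> - x \<in> Y"
proof -
  \<comment> \<open>\<open>SOME\<close> depends only on the set \<open>{x, - x}\<close>, so both
    points make the same choice and \<open>Y\<close> gets exactly one of them.\<close>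
  define pick where "pick = (\<lambda>x :: real^'n. SOME z. z \<in> {x, - x})"
  have pick: "pick x \<in> {x, - x}" for x unfolding pick_def by (rule someI[of _ x]) simp
  have pick_minus: "pick (- x) = pick x" for x
    unfolding pick_def by (simp add: insert_commute)
  have neg: "- x \<in> X" if "x \<in> X" for x using that assms(3) by (metis image_eqI)
  define Y where "Y = {x \<in> X. pick x = x}"
  have "x \<noteq> - x" if "x \<in> X" for x
  proof
    assume "x = - x"
    then have "x + x = 0" by (metis right_minus)
    then have "x = 0" by (simp flip: scaleR_2)
    then show False using that assms(2) by simp
  qed
  then have disj: "Y \<inter> uminus ` Y = {}"
    unfolding Y_def using pick_minus by force
  have "x \<in> Y \<or> - x \<in> Y" if "x \<in> X" for x
    using pick[of x] pick_minus[of x] that neg[OF that] by (auto simp: Y_def)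
  moreover have "X = Y \<union> uminus ` Y"
    using calculation neg by (force simp: Y_def image_iff)
  moreover from this have "card X = card Y + card (uminus ` Y)"
    using disj assms(1) by (metis card_Un_disjoint finite_Un)
  then have "card X = 2 * card Y" by (simp add: card_image)
  moreover have "Y \<subseteq> X" by (auto simp: Y_def)
  ultimately show ?thesis using that by blast
qed

theorem theorem1p7:
  fixes X :: "(real ^ 'n::finite) set"
    and w :: "real ^ 'n \<Rightarrow> real"
    and t p e :: nat
  assumes "CARD('n) \<ge> 2"
    and "finite X"
    and "0 \<notin> X"
    and "\<And>x. x \<in> X \<Longrightarrow> w x > 0"
    and "strong_euclidean_design t X w"
    and "card (norm ` X) = p"
    and "p \<ge> e + 1"
  shows "(t = 2 * e \<longrightarrow>
            card X \<ge> (e + 1) * (((CARD('n) + e - 1) choose e) +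
              (if e = 0 then 0 else (CARD('n) + e - 2) choose (e - 1)))) \<and>
         (t = 2 * e + 1 \<and> antipodal X w \<longrightarrow>
            card X \<ge> 2 * (e + 1) * ((CARD('n) + e - 1) choose e))"
proof (intro conjI impI)
  have norms: "card (norm ` X) > e" using assms(6,7) by simp
  note bound = design_card_ge[OF assms(1-5) _ norms]
  show "card X \<ge> (e + 1) * (((CARD('n) + e - 1) choose e) +
              (if e = 0 then 0 else (CARD('n) + e - 2) choose (e - 1)))" if t: "t = 2 * e"
  proof -
    \<comment> \<open>Multiplying by the squared norm, which is 1 on the sphere, raises degrees by
      two; so degrees \<open>e\<close> and \<open>e - 1\<close> account for all polynomials of
      degree at most \<open>e\<close>. For \<open>e = 0\<close> truncated subtraction would repeat
      the same set.\<close>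
    define M :: "('n \<Rightarrow> nat) set" where "M = expts e \<union> (if e = 0 then {} else expts (e - 1))"
    have "card M = card (expts e :: ('n \<Rightarrow> nat) set) + card (if e = 0 then {} else expts (e - 1) :: ('n \<Rightarrow> nat) set)"
      unfolding M_def by (rule card_Un_disjoint) (simp, simp, auto simp: expts_def)
    also have "\<dots> = ((CARD('n) + e - 1) choose e) + (if e = 0 then 0 else (CARD('n) + e - 2) choose (e - 1))"
      by (cases e) (simp_all add: card_expts)
    finally have card: "card M = \<dots>" .
    have "sph_pos_def M"
    proof (cases "e = 0")
      case True
      then show ?thesis using sph_pos_def_expts[of e, where 'n = 'n] by (simp add: M_def)
    next
      case False
      then show ?thesis
        unfolding M_def
        by (simp, intro sph_pos_def_Un sph_pos_def_expts finite_expts) (auto simp: expts_def)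
    qed
    moreover have "finite M" by (simp add: M_def)
    moreover have "sum \<alpha> UNIV \<le> e" if "\<alpha> \<in> M" for \<alpha>
      using that by (auto simp: M_def expts_def split: if_splits)
    ultimately have "(e + 1) * card M \<le> card X"
      using assms(2) t by (intro bound) auto
    then show ?thesis unfolding card .
  qed
  show "card X \<ge> 2 * (e + 1) * ((CARD('n) + e - 1) choose e)" if t: "t = 2 * e + 1 \<and> antipodal X w"
  proof -
    obtain Y where Y: "Y \<subseteq> X" "card X = 2 * card Y" "\<And>x. x \<in> X \<Longrightarrow> x \<in> Y \<or> - x \<in> Y"
      using antipodal_half[OF assms(2,3)] t unfolding antipodal_def by blast
    have "(e + 1) * card (expts e :: ('n \<Rightarrow> nat) set) \<le> card Y"
    proof (rule bound)
      fix c :: "nat \<times> ('n \<Rightarrow> nat) \<Rightarrow> real" and x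
      let ?F = "\<lambda>x. \<Sum>(i, \<alpha>)\<in>{..e} \<times> expts e. c (i, \<alpha>) * (norm x ^ i * mon \<alpha> (sgn x))"
      assume F: "\<forall>y\<in>Y. ?F y = 0" and "x \<in> X"
      \<comment> \<open>All monomials here have degree \<open>e\<close> and the norm is even, so
        \<open>?F\<close> has the parity of \<open>e\<close> and its zeros on \<open>Y\<close>
        extend to \<open>X\<close>.\<close>
      have "?F (- x) = (- 1) ^ e * ?F x"
      proof -
        have "mon \<alpha> (sgn (- x)) = (- 1) ^ e * mon \<alpha> (sgn x)" if "\<alpha> \<in> expts e" for \<alpha>
          using mon_scaleR[of \<alpha> "- 1" "sgn x"] that by (simp add: expts_def sgn_minus)
        then show ?thesis
          unfolding sum_distrib_left by (intro sum.cong refl) auto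
      qed
      then show "?F x = 0" using F Y(3)[OF \<open>x \<in> X\<close>] by auto
    next
      show "sum \<alpha> UNIV \<le> e" if "\<alpha> \<in> expts e" for \<alpha> :: "'n \<Rightarrow> nat"
        using that by (simp add: expts_def)
    qed (use t finite_subset[OF Y(1) assms(2)] in \<open>auto simp: sph_pos_def_expts\<close>)
    then show ?thesis using Y(2) by (simp add: card_expts)
  qed
qed

end
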